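(* Suppose $0\le\gamma<1$ and $1<p\le q\le\infty$, $p<\infty$. Let $(X,\rho,\mu)$ be a space of homogeneous type, and let $\sigma$ and $\omega$ be positive $\sigma$-finite Borel measures on $X$. Let $M_{\mu,\gamma}$ be the fractional maximal operator $$M_{\mu,\gamma}f(x):=\sup_{B}\frac{\chi_B(x)}{\mu(B)^{1-\gamma}}\int_B|f|\,d\mu,\qquad x\in X,$$ the supremum being over all balls $B$. Then the strong type norm inequality $$\|M_{\mu,\gamma}f\|_{L^q_\omega}\le N\|f\|_{L^p_\sigma}$$ holds for all $f\in L^p_\sigma$ if and only if $\mu\ll\sigma$ and the testing condition $$\left\|\chi_Q M_{\mu,\gamma}\left(\chi_Q\left[\frac{d\mu}{d\sigma}\right]^{1/(p-1)}\right)\right\|_{L^q_\omega}\le N_1\left\|\chi_Q\left[\frac{d\mu}{d\sigma}\right]^{1/(p-1)}\right\|_{L^p_\sigma}<\infty$$ holds for all dyadic cubes $Q\in\bigcup_{t=1}^L\mathscr{D}^t$. Moreover, $N\le cN_1$, where $c$ is a constant depending only on $X,\mu,\gamma,p$ and $q$.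
   Context: Space of homogeneous type: $(X,\rho)$ is a quasi-metric space ($\rho$ satisfies the axioms of a metric except that the triangle inequality is weakened to $\rho(x,y)\le A_0(\rho(x,z)+\rho(z,y))$ with a constant $A_0\ge1$), balls $B(x,r)=\{y:\rho(y,x)<r\}$ are measurable, and $\mu$ is a positive Borel measure with $0<\mu(B(x,2r))\le C_\mu\,\mu(B(x,r))<\infty$ for all $x\in X$, $r>0$, with a constant $C_\mu>0$ independent of $x,r$. Such a space is geometrically doubling: there is a positive integer $A_1$ such that every ball $B(x,r)$ can be covered by at most $A_1$ balls $B(x_i,r/2)$. The measures $\sigma,\omega$ are not assumed doubling. $d\mu/d\sigma$ denotes the Radon–Nikodym derivative. $N$ and $N_1$ denote finite constants independent of $f$ and of $Q$, respectively (in $N\le cN_1$ they are the best constants). Adjacent dyadic systems. Fix $\delta\in(0,1)$ with $96A_0^6\delta\le 1$, a point $x_0\in X$, and a finite collection $\mathscr{D}^t$, $t=1,\dots,L$, with $L=L(A_0,A_1,\delta)<\infty$, having the following properties (such collections are known to exist). Each $\mathscr{D}^t$ is a countable family of Borel sets $Q^k_\alpha$, $k\in\mathbb{Z}$, $\alpha\in\mathscr{A}_k$ (dyadic cubes of generation $k$, identified by the index pair $(k,\alpha)$), with center points $z^k_\alpha$, such that: for every $k$, $X=\bigcup_\alpha Q^k_\alpha$ (disjoint union); if $\ell\ge k$ then either $Q^\ell_\beta\subseteq Q^k_\alpha$ or $Q^k_\alpha\cap Q^\ell_\beta=\varnothing$; $B(z^k_\alpha,c_1\delta^k)\subseteq Q^k_\alpha\subseteq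 B(z^k_\alpha,C_1\delta^k)=:B(Q^k_\alpha)$ with $c_1=(12A_0^4)^{-1}$, $C_1=4A_0^2$; if $\ell\ge k$ and $Q^\ell_\beta\subseteq Q^k_\alpha$ then $B(Q^\ell_\beta)\subseteq B(Q^k_\alpha)$; for every $k$ there is $\alpha$ with $x_0=z^k_\alpha$. Collectively: for every ball $B(x,r)$ with $\delta^{k+2}<r\le\delta^{k+1}$ there exist $t$ and $Q^k_\alpha\in\mathscr{D}^t$ with $B(x,r)\subseteq Q^k_\alpha$ and $\operatorname{diam}Q^k_\alpha\le Cr$, where $C=8A_0^3\delta^{-2}$. *)

theory Defs
  imports "HOL-Analysis.Analysis" "HOL-Probability.Essential_Supremum"
begin

section \<open>Spaces of homogeneous type\<close>

definition quasi_metric :: "('a \<Rightarrow> 'a \<Rightarrow> real) \<Rightarrow> real \<Rightarrow> bool" where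
  "quasi_metric \<rho> A0 \<longleftrightarrow> 1 \<le> A0 \<and>
     (\<forall>x y. 0 \<le> \<rho> x y) \<and>
     (\<forall>x y. \<rho> x y = 0 \<longleftrightarrow> x = y) \<and>
     (\<forall>x y. \<rho> x y = \<rho> y x) \<and>
     (\<forall>x y z. \<rho> x y \<le> A0 * (\<rho> x z + \<rho> z y))"

definition qball :: "('a \<Rightarrow> 'a \<Rightarrow> real) \<Rightarrow> 'a \<Rightarrow> real \<Rightarrow> 'a set" where
  "qball \<rho> x r = {y. \<rho> y x < r}"

definition qdiam :: "('a \<Rightarrow> 'a \<Rightarrow> real) \<Rightarrow> 'a set \<Rightarrow> ennreal" where
  "qdiam \<rho> S = (SUP x\<in>S. SUP y\<in>S. ennreal (\<rho> x y))"

text \<open>The topology of a quasi-metric. Balls need not be open in it, which is why measurability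
  of the balls is a separate requirement below.\<close>

definition qopen :: "('a \<Rightarrow> 'a \<Rightarrow> real) \<Rightarrow> 'a set \<Rightarrow> bool" where
  "qopen \<rho> U \<longleftrightarrow> (\<forall>x\<in>U. \<exists>r>0. qball \<rho> x r \<subseteq> U)"

definition qborel_sets :: "('a \<Rightarrow> 'a \<Rightarrow> real) \<Rightarrow> 'a set set" where
  "qborel_sets \<rho> = sigma_sets UNIV {U. qopen \<rho> U}"

definition homogeneous_type :: "('a \<Rightarrow> 'a \<Rightarrow> real) \<Rightarrow> real \<Rightarrow> 'a measure \<Rightarrow> bool" where
  "homogeneous_type \<rho> A0 \<mu> \<longleftrightarrow>
     quasi_metric \<rho> A0 \<and>
     sets \<mu> = qborel_sets \<rho> \<and>
     (\<forall>x r. qball \<rho> x r \<in> qborel_sets \<rho>) \<and>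
     (\<exists>C>0. \<forall>x r. 0 < r \<longrightarrow>
        0 < emeasure \<mu> (qball \<rho> x (2 * r)) \<and>
        emeasure \<mu> (qball \<rho> x (2 * r)) \<le> ennreal C * emeasure \<mu> (qball \<rho> x r) \<and>
        emeasure \<mu> (qball \<rho> x r) < \<infinity>)"

section \<open>Adjacent dyadic systems\<close>

text \<open>\<open>I k\<close> is the index set of generation \<open>k\<close>; taking indices in \<^typ>\<open>nat\<close> encodes that the
  family is countable. \<open>Q k \<alpha>\<close> is the cube and \<open>z k \<alpha>\<close> its center.\<close>

definition dyadic_system ::
  "('a \<Rightarrow> 'a \<Rightarrow> real) \<Rightarrow> real \<Rightarrow> real \<Rightarrow> 'a \<Rightarrow>
   (int \<Rightarrow> nat set) \<Rightarrow> (int \<Rightarrow> nat \<Rightarrow> 'a) \<Rightarrow> (int \<Rightarrow> nat \<Rightarrow> 'a set) \<Rightarrow> bool" where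
  "dyadic_system \<rho> A0 \<delta> x0 I z Q \<longleftrightarrow>
     (let c1 = inverse (12 * A0 ^ 4);
          C1 = 4 * A0 ^ 2;
          BQ = (\<lambda>k \<alpha>. qball \<rho> (z k \<alpha>) (C1 * \<delta> powi k))
      in
        (\<forall>k. \<forall>\<alpha>\<in>I k. Q k \<alpha> \<in> qborel_sets \<rho>) \<and>
        (\<forall>k. (\<Union>\<alpha>\<in>I k. Q k \<alpha>) = UNIV \<and> disjoint_family_on (Q k) (I k)) \<and>
        (\<forall>k l. k \<le> l \<longrightarrow> (\<forall>\<alpha>\<in>I k. \<forall>\<beta>\<in>I l. Q l \<beta> \<subseteq> Q k \<alpha> \<or> Q k \<alpha> \<inter> Q l \<beta> = {})) \<and>
        (\<forall>k. \<forall>\<alpha>\<in>I k. qball \<rho> (z k \<alpha>) (c1 * \<delta> powi k) \<subseteq> Q k \<alpha> \<and> Q k \<alpha> \<subseteq> BQ k \<alpha>) \<and>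
        (\<forall>k l. k \<le> l \<longrightarrow> (\<forall>\<alpha>\<in>I k. \<forall>\<beta>\<in>I l. Q l \<beta> \<subseteq> Q k \<alpha> \<longrightarrow> BQ l \<beta> \<subseteq> BQ k \<alpha>)) \<and>
        (\<forall>k. \<exists>\<alpha>\<in>I k. z k \<alpha> = x0))"

definition adjacent_dyadic_systems ::
  "('a \<Rightarrow> 'a \<Rightarrow> real) \<Rightarrow> real \<Rightarrow> real \<Rightarrow> nat \<Rightarrow> 'a \<Rightarrow>
   (nat \<Rightarrow> int \<Rightarrow> nat set) \<Rightarrow> (nat \<Rightarrow> int \<Rightarrow> nat \<Rightarrow> 'a) \<Rightarrow> (nat \<Rightarrow> int \<Rightarrow> nat \<Rightarrow> 'a set) \<Rightarrow> bool" where
  "adjacent_dyadic_systems \<rho> A0 \<delta> L x0 I z Q \<longleftrightarrow>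
     (\<forall>t\<in>{1..L}. dyadic_system \<rho> A0 \<delta> x0 (I t) (z t) (Q t)) \<and>
     (\<forall>x r k. \<delta> powi (k + 2) < r \<and> r \<le> \<delta> powi (k + 1) \<longrightarrow>
        (\<exists>t\<in>{1..L}. \<exists>\<alpha>\<in>I t k. qball \<rho> x r \<subseteq> Q t k \<alpha> \<and>
            qdiam \<rho> (Q t k \<alpha>) \<le> ennreal (8 * A0 ^ 3 * \<delta> powi (-2) * r)))"

definition dyadic_cubes ::
  "nat \<Rightarrow> (nat \<Rightarrow> int \<Rightarrow> nat set) \<Rightarrow> (nat \<Rightarrow> int \<Rightarrow> nat \<Rightarrow> 'a set) \<Rightarrow> 'a set set" where
  "dyadic_cubes L I Q = (\<Union>t\<in>{1..L}. \<Union>k. Q t k ` I t k)"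

section \<open>Lebesgue norms of extended nonnegative functions\<close>

text \<open>Only meant for exponents \<open>a > 0\<close>.\<close>

definition enn_powr :: "ennreal \<Rightarrow> real \<Rightarrow> ennreal" where
  "enn_powr x a = (if x = \<infinity> then \<infinity> else ennreal (enn2real x powr a))"

definition Lq_norm_meas :: "'a measure \<Rightarrow> ennreal \<Rightarrow> ('a \<Rightarrow> ennreal) \<Rightarrow> ennreal" where
  "Lq_norm_meas M q h =
     (if q = \<infinity> then esssup M h
      else enn_powr (\<integral>\<^sup>+x. enn_powr (h x) (enn2real q) \<partial>M) (1 / enn2real q))"

text \<open>The maximal function below is a supremum over uncountably many balls, which need not be
  open, so it need not be measurable. Hence the norm of an arbitrary function is the outer one
  (as with an upper integral). On measurable functions it is the usual norm: see
  \<open>Lq_norm_measurable\<close>.\<close>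

definition Lq_norm :: "'a measure \<Rightarrow> ennreal \<Rightarrow> ('a \<Rightarrow> ennreal) \<Rightarrow> ennreal" where
  "Lq_norm M q g = (INF h\<in>{h \<in> borel_measurable M. g \<le> h}. Lq_norm_meas M q h)"

lemma enn_powr_mono:
  assumes "x \<le> y" "0 \<le> a" shows "enn_powr x a \<le> enn_powr y a"
proof (cases "y = \<infinity>")
  case False
  moreover from this have "x \<noteq> \<infinity>" using assms(1) by (auto simp: top_unique)
  ultimately show ?thesis using assms
    by (auto simp: enn_powr_def less_top intro!: ennreal_leI powr_mono2 enn2real_mono)
qed (simp add: enn_powr_def)

lemma Lq_norm_meas_mono:
  assumes "g \<in> borel_measurable M" "g \<le> h"
  shows "Lq_norm_meas M q g \<le> Lq_norm_meas M q h"
  using assms unfolding Lq_norm_meas_def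
  by (auto simp: le_fun_def intro!: esssup_mono enn_powr_mono nn_integral_mono)

lemma Lq_norm_measurable:
  assumes "g \<in> borel_measurable M"
  shows "Lq_norm M q g = Lq_norm_meas M q g"
  unfolding Lq_norm_def using assms
  by (auto intro!: antisym INF_lower INF_greatest Lq_norm_meas_mono)

section \<open>The maximal operator and the two inequalities\<close>

definition frac_maximal ::
  "('a \<Rightarrow> 'a \<Rightarrow> real) \<Rightarrow> 'a measure \<Rightarrow> real \<Rightarrow> ('a \<Rightarrow> ennreal) \<Rightarrow> 'a \<Rightarrow> ennreal" where
  "frac_maximal \<rho> \<mu> \<gamma> f x =
     (SUP (y, r) \<in> {(y, r). 0 < r}.
        indicator (qball \<rho> y r) x / enn_powr (emeasure \<mu> (qball \<rho> y r)) (1 - \<gamma>)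
          * (\<integral>\<^sup>+w\<in>qball \<rho> y r. f w \<partial>\<mu>))"

definition strong_type_constant ::
  "('a \<Rightarrow> 'a \<Rightarrow> real) \<Rightarrow> 'a measure \<Rightarrow> real \<Rightarrow> real \<Rightarrow> ennreal \<Rightarrow> 'a measure \<Rightarrow> 'a measure \<Rightarrow> ennreal \<Rightarrow> bool"
where
  "strong_type_constant \<rho> \<mu> \<gamma> p q \<sigma> \<omega> N \<longleftrightarrow> N < \<infinity> \<and>
     (\<forall>f :: 'a \<Rightarrow> real. f \<in> borel_measurable \<sigma> \<longrightarrow>
        Lq_norm \<sigma> (ennreal p) (\<lambda>x. ennreal \<bar>f x\<bar>) < \<infinity> \<longrightarrow>
        Lq_norm \<omega> q (frac_maximal \<rho> \<mu> \<gamma> (\<lambda>x. ennreal \<bar>f x\<bar>))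
          \<le> N * Lq_norm \<sigma> (ennreal p) (\<lambda>x. ennreal \<bar>f x\<bar>))"

text \<open>\<^term>\<open>RN_deriv \<sigma> \<mu>\<close> is \<open>d\<mu>/d\<sigma>\<close> (the base measure is the first argument).\<close>

definition testing_weight :: "'a measure \<Rightarrow> 'a measure \<Rightarrow> real \<Rightarrow> 'a set \<Rightarrow> 'a \<Rightarrow> ennreal" where
  "testing_weight \<mu> \<sigma> p S x = indicator S x * enn_powr (RN_deriv \<sigma> \<mu> x) (1 / (p - 1))"

definition testing_constant ::
  "('a \<Rightarrow> 'a \<Rightarrow> real) \<Rightarrow> 'a measure \<Rightarrow> real \<Rightarrow> real \<Rightarrow> ennreal \<Rightarrow> 'a measure \<Rightarrow> 'a measure \<Rightarrow>
   'a set set \<Rightarrow> ennreal \<Rightarrow> bool" where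
  "testing_constant \<rho> \<mu> \<gamma> p q \<sigma> \<omega> \<D> N1 \<longleftrightarrow> N1 < \<infinity> \<and>
     (\<forall>S\<in>\<D>.
        Lq_norm \<omega> q (\<lambda>x. indicator S x * frac_maximal \<rho> \<mu> \<gamma> (testing_weight \<mu> \<sigma> p S) x)
          \<le> N1 * Lq_norm \<sigma> (ennreal p) (testing_weight \<mu> \<sigma> p S) \<and>
        Lq_norm \<sigma> (ennreal p) (testing_weight \<mu> \<sigma> p S) < \<infinity>)"

end

theory Submission
  imports Defs
begin

text \<open>Write \<open>u = (d\<mu>/d\<sigma>)\<^bsup>1/(p-1)\<^esup>\<close>, \<open>d\<nu> = u d\<mu>\<close> and \<open>|f| = g u\<close>. Then \<open>\<integral>\<^sub>Q |f| d\<mu> = \<integral>\<^sub>Q g d\<nu>\<close> and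
  \<open>\<integral> g\<^sup>p d\<nu> \<le> \<integral> |f|\<^sup>p d\<sigma>\<close>, while the right-hand norm in the testing condition is \<open>\<nu>(Q)\<^bsup>1/p\<^esup>\<close>. By doubling,
  \<open>M f\<close> is comparable to the supremum of the averages \<open>\<mu>(Q)\<^bsup>\<gamma>-1\<^esup> \<integral>\<^sub>Q g d\<nu>\<close> over the cubes of the adjacent
  systems. For \<open>q < \<infinity>\<close> each system is treated separately: the cubes whose \<open>\<nu>\<close>-average of \<open>g\<close> lies in
  \<open>(2\<^sup>n, 2\<^bsup>n+1\<^esup>]\<close> are grouped under the maximal cubes \<open>R\<close> with average above \<open>2\<^sup>n\<close>; testing on \<open>R\<close> bounds
  their contribution by \<open>2\<^bsup>nq\<^esup> \<nu>(R)\<^bsup>q/p\<^esup>\<close>, and \<open>q \<ge> p\<close> allows to sum before taking the power \<open>q/p\<close>. For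
  \<open>q = \<infinity>\<close> Hoelder's inequality on each cube suffices. Conversely, the strong type inequality applied to
  functions supported in a bounded null set of \<open>\<sigma>\<close>, or to the truncations \<open>min u n\<close> on a cube, gives
  absolute continuity and the finiteness of \<open>\<nu>(Q)\<close>; testing is then the case \<open>f = u\<close> on \<open>Q\<close>.\<close>

section \<open>Real powers of extended nonnegative numbers\<close>

lemma enn_powr_ennreal: "0 \<le> x \<Longrightarrow> enn_powr (ennreal x) a = ennreal (x powr a)"
  by (simp add: enn_powr_def)

lemma enn_powr_top [simp]: "enn_powr top a = top"
  by (simp add: enn_powr_def)

lemma enn_powr_0 [simp]: "enn_powr 0 a = 0"
  by (simp add: enn_powr_def)

lemma enn_powr_one [simp]: "enn_powr x 1 = x"
  by (cases x) (simp_all add: enn_powr_ennreal)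

lemma enn_powr_eq_0_iff [simp]: "enn_powr x a = 0 \<longleftrightarrow> x = 0"
  by (cases x) (auto simp: enn_powr_ennreal)

lemma enn_powr_eq_top_iff [simp]: "enn_powr x a = top \<longleftrightarrow> x = top"
  by (cases x) (auto simp: enn_powr_ennreal)

lemma enn_powr_mult:
  assumes "0 < a"
  shows "enn_powr (x * y) a = enn_powr x a * enn_powr y a"
proof (cases "x = 0 \<or> y = 0")
  case False
  then show ?thesis
    by (cases x; cases y)
      (auto simp: enn_powr_ennreal ennreal_mult[symmetric] powr_mult ennreal_mult_top ennreal_top_mult)
qed auto

lemma enn_powr_powr: "enn_powr (enn_powr x a) b = enn_powr x (a * b)"
  by (cases x) (auto simp: enn_powr_ennreal powr_powr)

lemma enn_powr_one_plus:
  assumes "0 \<le> b"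
  shows "enn_powr x (1 + b) = x * enn_powr x b"
proof (cases x)
  case (real r)
  then show ?thesis
    by (auto simp: enn_powr_ennreal powr_add ennreal_mult[symmetric])
qed (simp add: ennreal_mult_top)

lemma borel_measurable_enn_powr [measurable]:
  assumes [measurable]: "f \<in> borel_measurable M"
  shows "(\<lambda>x. enn_powr (f x) a) \<in> borel_measurable M"
  unfolding enn_powr_def by measurable

lemma enn_powr_le_iff:
  assumes "0 < a"
  shows "enn_powr x a \<le> enn_powr y a \<longleftrightarrow> x \<le> y"
proof
  assume "enn_powr x a \<le> enn_powr y a"
  then have "enn_powr (enn_powr x a) (1 / a) \<le> enn_powr (enn_powr y a) (1 / a)"
    by (rule enn_powr_mono) (use assms in auto)
  then show "x \<le> y" using assms by (simp add: enn_powr_powr)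
qed (use assms in \<open>auto intro: enn_powr_mono\<close>)

lemma enn_powr_le_iff_root:
  assumes "0 < a"
  shows "enn_powr x a \<le> y \<longleftrightarrow> x \<le> enn_powr y (1 / a)"
  using enn_powr_le_iff[of a x "enn_powr y (1 / a)"] assms by (simp add: enn_powr_powr)

text \<open>For a positive exponent the power is an order isomorphism, with the power
  \<open>1 / a\<close> as its inverse, so it preserves suprema.\<close>

lemma enn_powr_SUP:
  assumes "0 < a"
  shows "enn_powr (SUP i\<in>A. f i) a = (SUP i\<in>A. enn_powr (f i) a)"
proof (rule antisym)
  show "enn_powr (SUP i\<in>A. f i) a \<le> (SUP i\<in>A. enn_powr (f i) a)"
    unfolding enn_powr_le_iff_root[OF assms]
    by (rule SUP_least, subst enn_powr_le_iff_root[OF assms, symmetric]) (rule SUP_upper)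
  show "(SUP i\<in>A. enn_powr (f i) a) \<le> enn_powr (SUP i\<in>A. f i) a"
    using assms by (intro SUP_least enn_powr_mono SUP_upper) auto
qed

text \<open>Each term is at most the total \<open>S\<close>. Hence one factor \<open>f i\<close> of
  the power is kept and the remaining \<open>s - 1\<close> powers are bounded by powers of
  \<open>S\<close>.\<close>

lemma nn_integral_count_space_enn_powr_le:
  assumes "1 \<le> s"
  shows "(\<integral>\<^sup>+i. enn_powr (f i) s \<partial>count_space A) \<le> enn_powr (\<integral>\<^sup>+i. f i \<partial>count_space A) s"
proof -
  define S where "S = (\<integral>\<^sup>+i. f i \<partial>count_space A)"
  have eq: "enn_powr x s = x * enn_powr x (s - 1)" for x
    using enn_powr_one_plus[of "s - 1" x] assms by simp
  have "(\<integral>\<^sup>+i. enn_powr (f i) s \<partial>count_space A) \<le> (\<integral>\<^sup>+i. f i * enn_powr S (s - 1) \<partial>count_space A)"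
    using assms unfolding S_def
    by (intro nn_integral_mono) (auto simp: eq intro!: mult_left_mono enn_powr_mono nn_integral_ge_point)
  also have "\<dots> = S * enn_powr S (s - 1)"
    by (subst nn_integral_multc) (auto simp: S_def)
  finally show ?thesis
    by (simp add: eq S_def)
qed

text \<open>The admissible levels form a half-line bounded above, so the sum is geometric and
  comparable to its last term, which is of the order of \<open>enn_powr x a\<close>. For x zero the
  sum is empty, for x infinite the bound is infinite.\<close>

lemma nn_integral_geometric_level_le:
  fixes a :: real and x :: ennreal
  assumes "0 < a"
  shows "(\<integral>\<^sup>+n. ennreal (2 powr (real_of_int n * a)) * indicator {n. ennreal (2 powr (real_of_int n - 1)) < x} n
            \<partial>count_space UNIV)
      \<le> ennreal (2 powr a / (1 - 2 powr (- a))) * enn_powr x a"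
proof (cases "x = 0 \<or> x = top")
  case True
  have "0 < 2 powr a / (1 - 2 powr (- a))"
    using assms powr_less_mono[of "- a" 0 2] by simp
  then show ?thesis using True by (auto simp: ennreal_mult_top)
next
  case False
  then obtain g where g: "x = ennreal g" "0 < g" by (cases x) auto
  \<comment> \<open>The last admissible level: \<open>n - 1 < log 2 g\<close> amounts to
    \<open>n \<le> m\<close>, and rounding up costs at most a factor 2 in
    \<open>2 powr m\<close>.\<close>
  define m where "m = \<lceil>log 2 g\<rceil>"
  have iff: "ennreal (2 powr (real_of_int n - 1)) < x \<longleftrightarrow> n \<le> m" for n :: int
  proof -
    have "ennreal (2 powr (real_of_int n - 1)) < x \<longleftrightarrow> real_of_int n - 1 < log 2 g"
      using g by (simp add: ennreal_less_iff less_log_iff)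
    also have "\<dots> \<longleftrightarrow> n \<le> m"
      unfolding m_def by linarith
    finally show ?thesis .
  qed
  have "2 powr real_of_int m \<le> 2 powr (log 2 g + 1)"
    unfolding m_def by (intro powr_mono) linarith+
  also have "\<dots> = 2 * g" using g by (simp add: powr_add)
  finally have m: "2 powr (real_of_int m) \<le> 2 * g" .
  \<comment> \<open>Counting downwards from \<open>m\<close> turns the sum over the half-line into a
    series with ratio \<open>2 powr (- a)\<close>, which is less than 1.\<close>
  have bij: "bij_betw (\<lambda>j. m - int j) UNIV {..m}"
    by (rule bij_betwI[where g = "\<lambda>n. nat (m - n)"]) auto
  have r: "0 \<le> 2 powr (- a)" "2 powr (- a) < 1"
    using assms powr_less_mono[of "- a" 0 2] by simp_all
  have "(\<integral>\<^sup>+n. ennreal (2 powr (real_of_int n * a)) * indicator {n. ennreal (2 powr (real_of_int n - 1)) < x} n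
            \<partial>count_space UNIV) = (\<integral>\<^sup>+n. ennreal (2 powr (real_of_int n * a)) \<partial>count_space {..m})"
    by (subst nn_integral_count_space_indicator) (auto simp: iff indicator_def intro!: nn_integral_cong)
  also have "\<dots> = (\<integral>\<^sup>+j. ennreal (2 powr (real_of_int (m - int j) * a)) \<partial>count_space UNIV)"
    by (rule nn_integral_bij_count_space[OF bij, symmetric])
  also have "\<dots> = (\<Sum>j. ennreal (2 powr (real_of_int m * a) * (2 powr (- a)) ^ j))"
    by (simp add: nn_integral_count_space_nat powr_realpow[symmetric] powr_powr powr_add[symmetric] algebra_simps)
  also have "\<dots> = ennreal (2 powr (real_of_int m * a) * (1 / (1 - 2 powr (- a))))"
    using r by (intro suminf_ennreal_eq sums_mult geometric_sums) auto
  also have "\<dots> \<le> ennreal ((2 * g) powr a * (1 / (1 - 2 powr (- a))))"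
    using r m assms powr_mono2[OF _ _ m, of a]
    by (intro ennreal_leI mult_right_mono) (auto simp: powr_powr)
  also have "\<dots> = ennreal (2 powr a / (1 - 2 powr (- a))) * enn_powr x a"
    using g r by (simp add: enn_powr_ennreal powr_mult ennreal_mult[symmetric] field_simps)
  finally show ?thesis .
qed

section \<open>Testing over laminar families\<close>

lemma borel_measurable_nn_integral_count_space:
  fixes f :: "'i \<Rightarrow> 'a \<Rightarrow> ennreal"
  assumes "countable I" and [measurable]: "\<And>i. i \<in> I \<Longrightarrow> f i \<in> borel_measurable M"
  shows "(\<lambda>x. \<integral>\<^sup>+i. f i x \<partial>count_space I) \<in> borel_measurable M"
proof (cases "finite I")
  case True
  then show ?thesis by (simp add: nn_integral_count_space_finite)
next
  case False
  then have [measurable]: "f (from_nat_into I n) \<in> borel_measurable M" for n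
    by (intro assms(2) from_nat_into) auto
  have "(\<integral>\<^sup>+i. f i x \<partial>count_space I) = (\<Sum>n. f (from_nat_into I n) x)" for x
    using nn_integral_bij_count_space[OF bij_betw_from_nat_into[OF assms(1) False], of "\<lambda>i. f i x"]
    by (simp add: nn_integral_count_space_nat)
  then show ?thesis by simp
qed

text \<open>Countable additivity of the measure with density \<open>f\<close>: the left-hand side is
  its value on the union of the disjoint sets.\<close>

lemma nn_integral_count_space_set_nn_integral_le:
  assumes [measurable]: "f \<in> borel_measurable M"
    and "countable \<R>" "disjoint \<R>" "\<R> \<subseteq> sets M"
  shows "(\<integral>\<^sup>+R. (\<integral>\<^sup>+x\<in>R. f x \<partial>M) \<partial>count_space \<R>) \<le> (\<integral>\<^sup>+x. f x \<partial>M)"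
proof -
  have "(\<integral>\<^sup>+R. (\<integral>\<^sup>+x\<in>R. f x \<partial>M) \<partial>count_space \<R>) = (\<integral>\<^sup>+R. emeasure (density M f) R \<partial>count_space \<R>)"
    using assms by (intro nn_integral_cong) (auto simp: emeasure_density)
  also have "\<dots> = emeasure (density M f) (\<Union>R\<in>\<R>. R)"
    using assms by (intro emeasure_UN_countable[symmetric]) (auto simp: disjoint_family_on_def disjoint_def)
  also have "\<dots> \<le> emeasure (density M f) (space (density M f))"
    by (rule emeasure_space)
  also have "\<dots> = (\<integral>\<^sup>+x. f x \<partial>M)"
    by (auto simp: emeasure_density intro!: nn_integral_cong)
  finally show ?thesis .
qed

text \<open>The outer factor 2 comes from halving the average on each set; the quotient is the
  geometric constant of \<open>nn_integral_geometric_level_le\<close> at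
  \<open>a = p - 1\<close>.\<close>

definition level_const :: "real \<Rightarrow> real" where
  "level_const p = 2 * (2 powr (p - 1) / (1 - 2 powr (- (p - 1))))"

lemma level_const_pos: "1 < p \<Longrightarrow> 0 < level_const p"
  unfolding level_const_def using powr_less_mono[of "- (p - 1)" 0 2] by simp

text \<open>Plays the role of the dyadic maximal theorem: on a set where the average of \<open>g\<close> exceeds
  \<open>2\<^sup>n\<close>, the part of \<open>g\<close> above \<open>2\<^sup>n\<^sup>-\<^sup>1\<close> already has average at least \<open>2\<^sup>n\<^sup>-\<^sup>1\<close>.\<close>

lemma nn_integral_level_families_le:
  fixes p :: real and \<nu> :: "'a measure" and \<R> :: "int \<Rightarrow> 'a set set"
  assumes p: "1 < p" and [measurable]: "g \<in> borel_measurable \<nu>"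
    and \<R>: "\<And>n. countable (\<R> n)" "\<And>n. disjoint (\<R> n)" "\<And>n. \<R> n \<subseteq> sets \<nu>"
    and fin: "\<And>n R. R \<in> \<R> n \<Longrightarrow> emeasure \<nu> R < top"
    and avg: "\<And>n R. R \<in> \<R> n \<Longrightarrow> ennreal (2 powr n) * emeasure \<nu> R \<le> (\<integral>\<^sup>+x\<in>R. g x \<partial>\<nu>)"
  shows "(\<integral>\<^sup>+n. \<integral>\<^sup>+R. ennreal (2 powr (n * p)) * emeasure \<nu> R \<partial>count_space (\<R> n) \<partial>count_space UNIV)
    \<le> ennreal (level_const p) * (\<integral>\<^sup>+x. enn_powr (g x) p \<partial>\<nu>)"
proof -
  define G where "G n x = g x * indicator {x. ennreal (2 powr (real_of_int n - 1)) < g x} x" for n x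
  have [measurable]: "G n \<in> borel_measurable \<nu>" for n
    unfolding G_def by measurable
  \<comment> \<open>The points where \<open>g\<close> is at most \<open>2 powr (n - 1)\<close>
    contribute at most \<open>h\<close>, half of the lower bound for the integral; the other half
    must come from \<open>G n\<close>.\<close>
  have R_le: "ennreal (2 powr (n * p)) * emeasure \<nu> R \<le> ennreal (2 * 2 powr (n * (p - 1))) * (\<integral>\<^sup>+x\<in>R. G n x \<partial>\<nu>)"
    if "R \<in> \<R> n" for n :: int and R
  proof -
    have [measurable]: "R \<in> sets \<nu>" using that \<R> by auto
    define h where "h = ennreal (2 powr (real_of_int n - 1)) * emeasure \<nu> R"
    have "ennreal (2 powr n) = ennreal (2 powr (real_of_int n - 1)) + ennreal (2 powr (real_of_int n - 1))"
      by (subst ennreal_plus[symmetric]) (auto simp: powr_diff)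
    then have "h + h = ennreal (2 powr n) * emeasure \<nu> R"
      by (simp add: h_def distrib_right)
    also have "\<dots> \<le> (\<integral>\<^sup>+x\<in>R. g x \<partial>\<nu>)"
      using avg that by simp
    also have "\<dots> \<le> (\<integral>\<^sup>+x. ennreal (2 powr (real_of_int n - 1)) * indicator R x + G n x * indicator R x \<partial>\<nu>)"
      by (intro nn_integral_mono) (auto simp: G_def indicator_def)
    also have "\<dots> = h + (\<integral>\<^sup>+x\<in>R. G n x \<partial>\<nu>)"
      by (subst nn_integral_add) (auto simp: h_def nn_integral_cmult_indicator)
    \<comment> \<open>Cancelling \<open>h\<close> on both sides is legitimate because
      \<open>R\<close> has finite measure.\<close>
    finally have "h \<le> (\<integral>\<^sup>+x\<in>R. G n x \<partial>\<nu>)"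
      using fin[OF that]
      by (auto simp: h_def ennreal_add_left_cancel_le ennreal_mult_eq_top_iff)
    then have "ennreal (2 * 2 powr (n * (p - 1))) * h
        \<le> ennreal (2 * 2 powr (n * (p - 1))) * (\<integral>\<^sup>+x\<in>R. G n x \<partial>\<nu>)"
      by (rule mult_left_mono) simp
    moreover have "ennreal (2 * 2 powr (n * (p - 1))) * h = ennreal (2 powr (n * p)) * emeasure \<nu> R"
    proof -
      have "2 * 2 powr (n * (p - 1)) * 2 powr (real_of_int n - 1) = 2 powr (1 + (n * (p - 1)) + (real_of_int n - 1))"
        by (simp only: powr_add) simp
      also have "1 + (n * (p - 1)) + (real_of_int n - 1) = n * p"
        by (simp add: algebra_simps)
      finally have "ennreal (2 * 2 powr (n * (p - 1))) * ennreal (2 powr (real_of_int n - 1)) = ennreal (2 powr (n * p))"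
        by (subst ennreal_mult[symmetric]) auto
      then show ?thesis by (simp only: h_def mult.assoc[symmetric])
    qed
    ultimately show ?thesis by simp
  qed
  have "(\<integral>\<^sup>+n. \<integral>\<^sup>+R. ennreal (2 powr (n * p)) * emeasure \<nu> R \<partial>count_space (\<R> n) \<partial>count_space UNIV)
    \<le> (\<integral>\<^sup>+n. ennreal (2 * 2 powr (n * (p - 1))) * (\<integral>\<^sup>+x. G n x \<partial>\<nu>) \<partial>count_space UNIV)"
  proof (intro nn_integral_mono)
    fix n :: int
    have "(\<integral>\<^sup>+R. ennreal (2 powr (n * p)) * emeasure \<nu> R \<partial>count_space (\<R> n))
        \<le> (\<integral>\<^sup>+R. ennreal (2 * 2 powr (n * (p - 1))) * (\<integral>\<^sup>+x\<in>R. G n x \<partial>\<nu>) \<partial>count_space (\<R> n))"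
      by (intro nn_integral_mono) (auto simp: R_le)
    also have "\<dots> = ennreal (2 * 2 powr (n * (p - 1))) * (\<integral>\<^sup>+R. (\<integral>\<^sup>+x\<in>R. G n x \<partial>\<nu>) \<partial>count_space (\<R> n))"
      by (rule nn_integral_cmult) simp
    also have "\<dots> \<le> ennreal (2 * 2 powr (n * (p - 1))) * (\<integral>\<^sup>+x. G n x \<partial>\<nu>)"
      using \<R> by (intro mult_left_mono nn_integral_count_space_set_nn_integral_le) auto
    finally show "(\<integral>\<^sup>+R. ennreal (2 powr (n * p)) * emeasure \<nu> R \<partial>count_space (\<R> n)) \<le> \<dots>" .
  qed
  also have "\<dots> = (\<integral>\<^sup>+n. \<integral>\<^sup>+x. ennreal (2 * 2 powr (n * (p - 1))) * G n x \<partial>\<nu> \<partial>count_space UNIV)"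
    by (intro nn_integral_cong nn_integral_cmult[symmetric]) measurable
  \<comment> \<open>After exchanging sum and integral, what remains at a fixed x is the geometric
    sum over the levels with \<open>2 powr (n - 1) < g x\<close>.\<close>
  also have "\<dots> = (\<integral>\<^sup>+x. \<integral>\<^sup>+n. ennreal (2 * 2 powr (n * (p - 1))) * G n x \<partial>count_space UNIV \<partial>\<nu>)"
    by (rule nn_integral_count_space_nn_integral[symmetric]) auto
  also have "\<dots> \<le> (\<integral>\<^sup>+x. ennreal (level_const p) * enn_powr (g x) p \<partial>\<nu>)"
  proof (intro nn_integral_mono)
    fix x
    let ?l = "\<lambda>n. ennreal (2 powr (real_of_int n * (p - 1))) * indicator {n. ennreal (2 powr (real_of_int n - 1)) < g x} n"
    have "(\<integral>\<^sup>+n. ennreal (2 * 2 powr (n * (p - 1))) * G n x \<partial>count_space UNIV)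
        = (\<integral>\<^sup>+n. (2 * g x) * ?l n \<partial>count_space UNIV)"
      by (intro nn_integral_cong) (auto simp: G_def ennreal_mult indicator_def ac_simps)
    also have "\<dots> = (2 * g x) * (\<integral>\<^sup>+n. ?l n \<partial>count_space UNIV)"
      by (rule nn_integral_cmult) simp
    also have "\<dots> \<le> (2 * g x) * (ennreal (2 powr (p - 1) / (1 - 2 powr (- (p - 1)))) * enn_powr (g x) (p - 1))"
      using p by (intro mult_left_mono nn_integral_geometric_level_le) auto
    also have "\<dots> = (2 * ennreal (2 powr (p - 1) / (1 - 2 powr (- (p - 1))))) * enn_powr (g x) p"
      using p enn_powr_one_plus[of "p - 1" "g x"] by (simp add: ac_simps)
    also have "2 * ennreal (2 powr (p - 1) / (1 - 2 powr (- (p - 1)))) = ennreal (level_const p)"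
      unfolding level_const_def ennreal_numeral[symmetric]
      using level_const_pos[OF p] by (subst ennreal_mult) (auto simp: level_const_def)
    finally show "(\<integral>\<^sup>+n. ennreal (2 * 2 powr (n * (p - 1))) * G n x \<partial>count_space UNIV)
        \<le> ennreal (level_const p) * enn_powr (g x) p" .
  qed
  also have "\<dots> = ennreal (level_const p) * (\<integral>\<^sup>+x. enn_powr (g x) p \<partial>\<nu>)"
    by (rule nn_integral_cmult) simp
  finally show ?thesis .
qed

text \<open>\<open>b Q\<close> stands for \<open>\<mu>(Q)\<^sup>\<gamma>\<^sup>-\<^sup>1\<close>. Each value \<open>b Q \<integral>\<^sub>Q g d\<nu>\<close> is split into \<open>b Q \<nu>(Q)\<close>, controlled by
  testing, and the average of \<open>g\<close>, located between two consecutive powers of \<open>2\<close>; the cubes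
  whose average exceeds \<open>2\<^sup>n\<close> are grouped under the maximal ones.\<close>

lemma laminar_maximal_testing:
  fixes p q :: real and \<nu> \<omega> :: "'a measure" and b :: "'a set \<Rightarrow> ennreal"
  assumes pq: "1 < p" "p \<le> q" and [measurable]: "g \<in> borel_measurable \<nu>"
    and sets_eq: "sets \<omega> = sets \<nu>"
    and \<D>: "countable \<D>" "\<D> \<subseteq> sets \<nu>"
    and laminar: "\<And>P Q. P \<in> \<D> \<Longrightarrow> Q \<in> \<D> \<Longrightarrow> P \<subseteq> Q \<or> Q \<subseteq> P \<or> P \<inter> Q = {}"
    and finite_above: "\<And>Q. Q \<in> \<D> \<Longrightarrow> finite {P \<in> \<D>. Q \<subseteq> P}"
    and fin: "\<And>Q. Q \<in> \<D> \<Longrightarrow> emeasure \<nu> Q < top"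
    and g_fin: "(\<integral>\<^sup>+x. enn_powr (g x) p \<partial>\<nu>) < top"
    and testing: "\<And>R. R \<in> \<D> \<Longrightarrow>
      (\<integral>\<^sup>+x. (SUP P\<in>{P \<in> \<D>. P \<subseteq> R}. indicator P x * enn_powr (b P * emeasure \<nu> P) q) \<partial>\<omega>)
        \<le> T * enn_powr (emeasure \<nu> R) (q / p)"
  shows "(\<integral>\<^sup>+x. (SUP Q\<in>\<D>. indicator Q x * enn_powr (b Q * (\<integral>\<^sup>+y\<in>Q. g y \<partial>\<nu>)) q) \<partial>\<omega>)
    \<le> ennreal (2 powr q) * T * enn_powr (ennreal (level_const p) * (\<integral>\<^sup>+x. enn_powr (g x) p \<partial>\<nu>)) (q / p)"
proof -
  define F where "F Q = (\<integral>\<^sup>+y\<in>Q. g y \<partial>\<nu>)" for Q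
  \<comment> \<open>The average is compared with \<open>2 powr n\<close> in multiplied form, which
    avoids division; sets of \<nu>-measure zero never belong to \<open>\<C> n\<close>. The maximal
    members form \<open>\<R> n\<close>, and \<open>S R\<close> is the function that the testing
    hypothesis controls on \<open>R\<close>.\<close>
  define \<C> where "\<C> n = {Q \<in> \<D>. ennreal (2 powr real_of_int n) * emeasure \<nu> Q < F Q}" for n
  define \<R> where "\<R> n = {R \<in> \<C> n. \<forall>P\<in>\<C> n. R \<subseteq> P \<longrightarrow> P = R}" for n
  define S where "S R x = (SUP P\<in>{P \<in> \<D>. P \<subseteq> R}. indicator P x * enn_powr (b P * emeasure \<nu> P) q)"
    for R x
  have \<R>_sub: "\<R> n \<subseteq> \<D>" for n by (auto simp: \<R>_def \<C>_def)
  have cnt: "countable (\<R> n)" for n using countable_subset[OF \<R>_sub \<D>(1)] .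
  have disj: "disjoint (\<R> n)" for n
  proof (rule disjointI)
    fix P R assume "P \<in> \<R> n" "R \<in> \<R> n" "P \<noteq> R"
    then show "P \<inter> R = {}"
      using laminar[of P R] by (auto simp: \<R>_def \<C>_def)
  qed
  have ind_meas [measurable]: "Q \<in> sets \<omega>" if "Q \<in> \<D>" for Q
    using that \<D> sets_eq by auto
  have S_meas: "S R \<in> borel_measurable \<omega>" for R
    unfolding S_def using \<D>(1)
    by (intro borel_measurable_SUP) (auto intro!: borel_measurable_times borel_measurable_indicator)
  have F_fin: "F Q < top" if "Q \<in> \<D>" for Q
  proof -
    have [measurable]: "Q \<in> sets \<nu>" using that \<D> by auto
    \<comment> \<open>This makes \<open>g\<close> integrable over every \<open>Q\<close> of finite
      measure, so that the average of \<open>g\<close> has a logarithm whenever it is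
      nonzero.\<close>
    have "z \<le> 1 + enn_powr z p" for z
    proof (cases "z \<le> 1")
      case False
      have "z * enn_powr 1 (p - 1) \<le> z * enn_powr z (p - 1)"
        using False pq by (intro mult_left_mono enn_powr_mono) auto
      then have "z \<le> enn_powr z p"
        using pq enn_powr_one_plus[of "p - 1" z] enn_powr_ennreal[of 1 "p - 1"] by simp
      then show ?thesis by (metis add_increasing zero_le)
    qed (simp add: add_increasing2)
    then have "F Q \<le> (\<integral>\<^sup>+x. indicator Q x + enn_powr (g x) p \<partial>\<nu>)"
      unfolding F_def by (intro nn_integral_mono) (auto simp: indicator_def)
    also have "\<dots> = emeasure \<nu> Q + (\<integral>\<^sup>+x. enn_powr (g x) p \<partial>\<nu>)"
      by (subst nn_integral_add) auto
    also have "\<dots> < top" using fin[OF that] g_fin by simp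
    finally show ?thesis .
  qed
  \<comment> \<open>A cube with nonzero integral has its average between two consecutive powers of
    2. It lies below a maximal \<open>R\<close> of that level, and its term is bounded by the single
    summand of the double sum at \<open>n\<close> and \<open>R\<close>.\<close>
  have pointwise: "(SUP Q\<in>\<D>. indicator Q x * enn_powr (b Q * F Q) q)
      \<le> (\<integral>\<^sup>+n. \<integral>\<^sup>+R. ennreal (2 powr ((real_of_int n + 1) * q)) * S R x \<partial>count_space (\<R> n) \<partial>count_space UNIV)"
    (is "_ \<le> ?rhs") for x
  proof (rule SUP_least)
    fix Q assume Q: "Q \<in> \<D>"
    show "indicator Q x * enn_powr (b Q * F Q) q \<le> ?rhs"
    proof (cases "x \<in> Q \<and> F Q \<noteq> 0")
      case True
      have "emeasure \<nu> Q \<noteq> 0"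
      proof
        assume "emeasure \<nu> Q = 0"
        then have "Q \<in> null_sets \<nu>" using Q \<D> by auto
        then have "F Q = 0" unfolding F_def by (simp add: nn_integral_null_set)
        then show False using True by simp
      qed
      then obtain v where v: "emeasure \<nu> Q = ennreal v" "0 < v"
        using fin[OF Q] by (cases "emeasure \<nu> Q") auto
      obtain f where f: "F Q = ennreal f" "0 < f"
        using F_fin[OF Q] True by (cases "F Q") auto
      \<comment> \<open>Rounding up and subtracting 1 makes the lower inequality strict, as
        membership in \<open>\<C> n\<close> requires.\<close>
      define n where "n = \<lceil>log 2 (f / v)\<rceil> - 1"
      have "real_of_int n < log 2 (f / v)" "log 2 (f / v) \<le> real_of_int n + 1"
        unfolding n_def by linarith+
      then have n: "2 powr n < f / v" "f / v \<le> 2 powr (real_of_int n + 1)"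
        using f v by (simp_all add: less_log_iff log_le_iff)
      have "Q \<in> \<C> n"
        using n v f Q by (simp add: \<C>_def ennreal_mult[symmetric] ennreal_less_iff field_simps)
      \<comment> \<open>Only finitely many members of the family contain \<open>Q\<close>, hence one
        of them is maximal in \<open>\<C> n\<close>.\<close>
      then have "\<exists>R\<in>{P \<in> \<C> n. Q \<subseteq> P}. Q \<subseteq> R \<and> (\<forall>P\<in>{P \<in> \<C> n. Q \<subseteq> P}. R \<subseteq> P \<longrightarrow> R = P)"
        by (intro finite_has_maximal2 finite_subset[OF _ finite_above[OF Q]]) (auto simp: \<C>_def)
      then obtain R where R: "R \<in> \<R> n" "Q \<subseteq> R"
        by (force simp: \<R>_def)
      have "F Q \<le> ennreal (2 powr (real_of_int n + 1)) * emeasure \<nu> Q"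
        using n v f by (simp add: ennreal_mult[symmetric] field_simps)
      then have "b Q * F Q \<le> ennreal (2 powr (real_of_int n + 1)) * (b Q * emeasure \<nu> Q)"
        by (metis mult.left_commute mult_left_mono zero_le)
      then have "enn_powr (b Q * F Q) q \<le> enn_powr \<dots> q"
        using pq by (intro enn_powr_mono) auto
      also have "\<dots> = ennreal (2 powr ((real_of_int n + 1) * q)) * enn_powr (b Q * emeasure \<nu> Q) q"
        using pq by (simp add: enn_powr_mult enn_powr_ennreal powr_powr)
      also have "\<dots> \<le> ennreal (2 powr ((real_of_int n + 1) * q)) * S R x"
        unfolding S_def using True Q R by (intro mult_left_mono SUP_upper2[of Q]) auto
      also have "\<dots> \<le> (\<integral>\<^sup>+R. ennreal (2 powr ((real_of_int n + 1) * q)) * S R x \<partial>count_space (\<R> n))"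
        using R by (rule_tac nn_integral_ge_point)
      also have "\<dots> \<le> ?rhs"
        by (rule nn_integral_ge_point) simp
      finally show ?thesis using True by simp
    qed auto
  qed
  have "(\<integral>\<^sup>+x. (SUP Q\<in>\<D>. indicator Q x * enn_powr (b Q * F Q) q) \<partial>\<omega>)
    \<le> (\<integral>\<^sup>+x. \<integral>\<^sup>+n. \<integral>\<^sup>+R. ennreal (2 powr ((real_of_int n + 1) * q)) * S R x \<partial>count_space (\<R> n) \<partial>count_space UNIV \<partial>\<omega>)"
    by (intro nn_integral_mono pointwise)
  also have "\<dots> = (\<integral>\<^sup>+n. \<integral>\<^sup>+R. \<integral>\<^sup>+x. ennreal (2 powr ((real_of_int n + 1) * q)) * S R x \<partial>\<omega> \<partial>count_space (\<R> n) \<partial>count_space UNIV)"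
    using S_meas cnt
    by (subst nn_integral_count_space_nn_integral)
      (auto intro!: nn_integral_cong nn_integral_count_space_nn_integral
        borel_measurable_nn_integral_count_space borel_measurable_times)
  also have "\<dots> \<le> (\<integral>\<^sup>+n. \<integral>\<^sup>+R. (ennreal (2 powr q) * T) * enn_powr (ennreal (2 powr (n * p)) * emeasure \<nu> R) (q / p)
        \<partial>count_space (\<R> n) \<partial>count_space UNIV)"
  proof (intro nn_integral_mono)
    fix n :: int and R assume "R \<in> space (count_space (\<R> n))"
    then have "R \<in> \<D>" using \<R>_sub by auto
    have "(\<integral>\<^sup>+x. ennreal (2 powr ((real_of_int n + 1) * q)) * S R x \<partial>\<omega>)
        = ennreal (2 powr ((real_of_int n + 1) * q)) * (\<integral>\<^sup>+x. S R x \<partial>\<omega>)"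
      using S_meas by (rule nn_integral_cmult)
    also have "\<dots> \<le> ennreal (2 powr ((real_of_int n + 1) * q)) * (T * enn_powr (emeasure \<nu> R) (q / p))"
      using testing[OF \<open>R \<in> \<D>\<close>] by (intro mult_left_mono) (auto simp: S_def)
    also have "\<dots> = (ennreal (2 powr q) * T) * enn_powr (ennreal (2 powr (n * p)) * emeasure \<nu> R) (q / p)"
    proof -
      have "2 powr ((real_of_int n + 1) * q) = 2 powr q * (2 powr (n * p)) powr (q / p)"
        using pq by (simp add: powr_powr powr_add[symmetric] algebra_simps)
      then show ?thesis
        using pq by (simp add: enn_powr_mult enn_powr_ennreal ennreal_mult ac_simps)
    qed
    finally show "(\<integral>\<^sup>+x. ennreal (2 powr ((real_of_int n + 1) * q)) * S R x \<partial>\<omega>)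
      \<le> (ennreal (2 powr q) * T) * enn_powr (ennreal (2 powr (n * p)) * emeasure \<nu> R) (q / p)" .
  qed
  also have "\<dots> = (ennreal (2 powr q) * T) * (\<integral>\<^sup>+n. \<integral>\<^sup>+R. enn_powr (ennreal (2 powr (n * p)) * emeasure \<nu> R) (q / p)
        \<partial>count_space (\<R> n) \<partial>count_space UNIV)"
    by (simp add: nn_integral_cmult)
  \<comment> \<open>Since \<open>q / p\<close> is at least 1, superadditivity pulls the power out of
    the sum over \<open>R\<close> and then out of the sum over \<open>n\<close>. This is where
    \<open>p \<le> q\<close> enters.\<close>
  also have "\<dots> \<le> (ennreal (2 powr q) * T) * (\<integral>\<^sup>+n. enn_powr (\<integral>\<^sup>+R. ennreal (2 powr (n * p)) * emeasure \<nu> R \<partial>count_space (\<R> n)) (q / p)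
        \<partial>count_space UNIV)"
    using pq by (intro mult_left_mono nn_integral_mono nn_integral_count_space_enn_powr_le) auto
  also have "\<dots> \<le> (ennreal (2 powr q) * T) * enn_powr (\<integral>\<^sup>+n. \<integral>\<^sup>+R. ennreal (2 powr (n * p)) * emeasure \<nu> R \<partial>count_space (\<R> n)
        \<partial>count_space UNIV) (q / p)"
    using pq by (intro mult_left_mono nn_integral_count_space_enn_powr_le) auto
  also have "\<dots> \<le> (ennreal (2 powr q) * T) * enn_powr (ennreal (level_const p) * (\<integral>\<^sup>+x. enn_powr (g x) p \<partial>\<nu>)) (q / p)"
  proof (intro mult_left_mono enn_powr_mono nn_integral_level_families_le)
    show "\<R> n \<subseteq> sets \<nu>" for n using \<R>_sub[of n] \<D> by auto
    show "R \<in> \<R> n \<Longrightarrow> emeasure \<nu> R < top" for n R using \<R>_sub[of n] fin by auto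
    show "R \<in> \<R> n \<Longrightarrow> ennreal (2 powr real_of_int n) * emeasure \<nu> R \<le> (\<integral>\<^sup>+x\<in>R. g x \<partial>\<nu>)" for n R
      by (auto simp: \<R>_def \<C>_def F_def)
  qed (use pq cnt disj in auto)
  finally show ?thesis unfolding F_def .
qed

text \<open>In a full dyadic system a cube may have infinitely many distinct ancestors, so maximal
  cubes need not exist. The estimate is therefore proved for the cubes of generation at least
  \<open>- n\<close>, with a bound independent of \<open>n\<close>, and monotone convergence removes
  the restriction.\<close>

lemma dyadic_maximal_testing:
  fixes p q :: real and \<nu> \<omega> :: "'a measure" and b :: "'a set \<Rightarrow> ennreal"
    and I :: "int \<Rightarrow> nat set" and Q :: "int \<Rightarrow> nat \<Rightarrow> 'a set"
  defines "\<D> \<equiv> (\<Union>k. Q k ` I k)"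
  assumes pq: "1 < p" "p \<le> q" and g: "g \<in> borel_measurable \<nu>"
    and sets_eq: "sets \<omega> = sets \<nu>"
    and \<D>: "\<D> \<subseteq> sets \<nu>" "{} \<notin> \<D>"
    and disj: "\<And>k. disjoint_family_on (Q k) (I k)"
    and nested: "\<And>k l \<alpha> \<beta>. k \<le> l \<Longrightarrow> \<alpha> \<in> I k \<Longrightarrow> \<beta> \<in> I l \<Longrightarrow> Q l \<beta> \<subseteq> Q k \<alpha> \<or> Q k \<alpha> \<inter> Q l \<beta> = {}"
    and fin: "\<And>Q. Q \<in> \<D> \<Longrightarrow> emeasure \<nu> Q < top"
    and g_fin: "(\<integral>\<^sup>+x. enn_powr (g x) p \<partial>\<nu>) < top"
    and testing: "\<And>R. R \<in> \<D> \<Longrightarrow>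
      (\<integral>\<^sup>+x. (SUP P\<in>{P \<in> \<D>. P \<subseteq> R}. indicator P x * enn_powr (b P * emeasure \<nu> P) q) \<partial>\<omega>)
        \<le> T * enn_powr (emeasure \<nu> R) (q / p)"
  shows "(\<integral>\<^sup>+x. (SUP Q\<in>\<D>. indicator Q x * enn_powr (b Q * (\<integral>\<^sup>+y\<in>Q. g y \<partial>\<nu>)) q) \<partial>\<omega>)
    \<le> ennreal (2 powr q) * T * enn_powr (ennreal (level_const p) * (\<integral>\<^sup>+x. enn_powr (g x) p \<partial>\<nu>)) (q / p)"
    (is "_ \<le> ?rhs")
proof -
  define \<E> where "\<E> n = (\<Union>k\<in>{- int n..}. Q k ` I k)" for n :: nat
  define H where "H Q x = indicator Q x * enn_powr (b Q * (\<integral>\<^sup>+y\<in>Q. g y \<partial>\<nu>)) q" for Q x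
  have \<E>_sub: "\<E> n \<subseteq> \<D>" for n by (auto simp: \<E>_def \<D>_def)
  have cnt: "countable (\<E> n)" for n
    unfolding \<E>_def by (intro countable_UN countable_image) auto
  have \<E>_cover: "\<exists>n. P \<in> \<E> n" if "P \<in> \<D>" for P
  proof -
    from that obtain k \<alpha> where "P = Q k \<alpha>" "\<alpha> \<in> I k" by (auto simp: \<D>_def)
    then have "P \<in> \<E> (nat (- k))" by (auto simp: \<E>_def)
    then show ?thesis ..
  qed
  have laminar: "P \<subseteq> R \<or> R \<subseteq> P \<or> P \<inter> R = {}" if PR: "P \<in> \<D>" "R \<in> \<D>" for P R
  proof -
    from PR obtain k \<alpha> l \<beta> where *: "P = Q k \<alpha>" "\<alpha> \<in> I k" "R = Q l \<beta>" "\<beta> \<in> I l"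
      by (auto simp: \<D>_def)
    show ?thesis
    proof (cases "k \<le> l")
      case True
      then show ?thesis using nested[OF True *(2,4)] * by auto
    next
      case False
      then show ?thesis using nested[OF _ *(4,2)] * by auto
    qed
  qed
  have finite_above: "finite {P \<in> \<E> n. R \<subseteq> P}" if "R \<in> \<E> n" for n R
  proof -
    have "R \<noteq> {}" using that \<E>_sub \<D>(2) by auto
    from that obtain k \<alpha> where R: "R = Q k \<alpha>" "\<alpha> \<in> I k" by (auto simp: \<E>_def)
    \<comment> \<open>Cubes of one generation are disjoint and \<open>R\<close> is nonempty, so at
      most one of them contains \<open>R\<close>.\<close>
    have *: "finite {P \<in> Q j ` I j. R \<subseteq> P}" for j
    proof (rule finite_subset)
      show "{P \<in> Q j ` I j. R \<subseteq> P} \<subseteq> {THE P. P \<in> Q j ` I j \<and> R \<subseteq> P}"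
      proof
        fix S assume "S \<in> {P \<in> Q j ` I j. R \<subseteq> P}"
        then obtain \<beta> where \<beta>: "S = Q j \<beta>" "\<beta> \<in> I j" "R \<subseteq> Q j \<beta>" by auto
        have "Q j \<beta> = (THE P. P \<in> Q j ` I j \<and> R \<subseteq> P)"
        proof (rule the_equality[symmetric])
          fix P assume "P \<in> Q j ` I j \<and> R \<subseteq> P"
          then obtain \<beta>' where "P = Q j \<beta>'" "\<beta>' \<in> I j" "R \<subseteq> Q j \<beta>'" by auto
          then show "P = Q j \<beta>"
            using \<beta> disj[of j] \<open>R \<noteq> {}\<close> unfolding disjoint_family_on_def by (cases "\<beta>' = \<beta>") blast+
        qed (use \<beta> in auto)
        with \<beta> show "S \<in> {THE P. P \<in> Q j ` I j \<and> R \<subseteq> P}" by simp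
      qed
    qed simp
    \<comment> \<open>A cube of a generation finer than \<open>k\<close> that contains
      \<open>R\<close> is also contained in \<open>R\<close>, hence equal to it as a set; all others
      lie in finitely many generations.\<close>
    have "{P \<in> \<E> n. R \<subseteq> P} \<subseteq> insert R (\<Union>j\<in>{- int n..k}. {P \<in> Q j ` I j. R \<subseteq> P})"
    proof
      fix P assume P: "P \<in> {P \<in> \<E> n. R \<subseteq> P}"
      then obtain j \<beta> where j: "P = Q j \<beta>" "\<beta> \<in> I j" "- int n \<le> j" by (auto simp: \<E>_def)
      show "P \<in> insert R (\<Union>j\<in>{- int n..k}. {P \<in> Q j ` I j. R \<subseteq> P})"
      proof (cases "j \<le> k")
        case False
        then have "P = R"
          using nested[of k j \<alpha> \<beta>] R j P \<open>R \<noteq> {}\<close> by auto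
        then show ?thesis by simp
      qed (use P j in auto)
    qed
    then show ?thesis
      by (rule finite_subset) (auto intro!: *)
  qed
  have step: "(\<integral>\<^sup>+x. (SUP P\<in>\<E> n. H P x) \<partial>\<omega>) \<le> ?rhs" for n
    unfolding H_def
  proof (rule laminar_maximal_testing)
    fix R assume R: "R \<in> \<E> n"
    have "(\<integral>\<^sup>+x. (SUP P\<in>{P \<in> \<E> n. P \<subseteq> R}. indicator P x * enn_powr (b P * emeasure \<nu> P) q) \<partial>\<omega>)
      \<le> (\<integral>\<^sup>+x. (SUP P\<in>{P \<in> \<D>. P \<subseteq> R}. indicator P x * enn_powr (b P * emeasure \<nu> P) q) \<partial>\<omega>)"
      using \<E>_sub by (intro nn_integral_mono SUP_subset_mono) auto
    also have "\<dots> \<le> T * enn_powr (emeasure \<nu> R) (q / p)"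
      using testing R \<E>_sub by auto
    finally show "(\<integral>\<^sup>+x. (SUP P\<in>{P \<in> \<E> n. P \<subseteq> R}. indicator P x * enn_powr (b P * emeasure \<nu> P) q) \<partial>\<omega>)
      \<le> T * enn_powr (emeasure \<nu> R) (q / p)" .
  qed (use pq g sets_eq \<D> fin g_fin cnt laminar finite_above \<E>_sub[of n] in \<open>auto simp: subset_iff\<close>)
  have H_meas: "H P \<in> borel_measurable \<omega>" if "P \<in> \<D>" for P
  proof -
    have [measurable]: "P \<in> sets \<omega>" using that \<D> sets_eq by auto
    show ?thesis unfolding H_def by measurable
  qed
  have "\<D> = (\<Union>n. \<E> n)" using \<E>_sub \<E>_cover by blast
  then have eq: "(SUP P\<in>\<D>. H P x) = (SUP n. SUP P\<in>\<E> n. H P x)" for x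
    by (simp only: SUP_UNION)
  have "(\<integral>\<^sup>+x. (SUP P\<in>\<D>. H P x) \<partial>\<omega>) = (SUP n. \<integral>\<^sup>+x. (SUP P\<in>\<E> n. H P x) \<partial>\<omega>)"
    unfolding eq
  proof (rule nn_integral_monotone_convergence_SUP)
    have "\<E> m \<subseteq> \<E> n" if "m \<le> n" for m n
      unfolding \<E>_def using that by (intro UN_mono) auto
    then show "incseq (\<lambda>n x. SUP P\<in>\<E> n. H P x)"
      by (intro monoI le_funI SUP_subset_mono) auto
    show "(\<lambda>x. SUP P\<in>\<E> n. H P x) \<in> borel_measurable \<omega>" for n
      using cnt H_meas \<E>_sub by (intro borel_measurable_SUP) auto
  qed
  also have "\<dots> \<le> ?rhs"
    by (intro SUP_least step)
  finally show ?thesis unfolding H_def .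
qed

section \<open>The geometry of dyadic cubes\<close>

text \<open>The exponent is negative for \<gamma> below 1, so the power is taken of the real number
  \<open>measure \<mu> A\<close>. This is the factor of the maximal operator whenever the measure is
  positive and finite, as it is for balls and cubes.\<close>

definition frac_weight :: "'a measure \<Rightarrow> real \<Rightarrow> 'a set \<Rightarrow> ennreal" where
  "frac_weight \<mu> \<gamma> A = ennreal (measure \<mu> A powr (\<gamma> - 1))"

locale homogeneous_space =
  fixes \<rho> :: "'a \<Rightarrow> 'a \<Rightarrow> real" and A0 :: real and \<mu> :: "'a measure"
  assumes homogeneous: "homogeneous_type \<rho> A0 \<mu>"
begin

lemma quasi_metric: "quasi_metric \<rho> A0"
  and sets_\<mu>: "sets \<mu> = qborel_sets \<rho>"
  and qball_borel: "qball \<rho> x r \<in> qborel_sets \<rho>"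
  using homogeneous unfolding homogeneous_type_def by auto

lemma A0_ge_1: "1 \<le> A0"
  and \<rho>_refl [simp]: "\<rho> x x = 0"
  using quasi_metric unfolding quasi_metric_def by blast+

lemma space_eq_UNIV:
  assumes "sets M = qborel_sets \<rho>"
  shows "space M = UNIV"
proof -
  have "UNIV \<in> qborel_sets \<rho>"
    unfolding qborel_sets_def by (rule sigma_sets_top)
  then show ?thesis
    using assms sets.sets_into_space[of UNIV M] by auto
qed

lemma qball_mono: "r \<le> s \<Longrightarrow> qball \<rho> x r \<subseteq> qball \<rho> x s"
  by (auto simp: qball_def)

lemma center_in_qball: "0 < r \<Longrightarrow> x \<in> qball \<rho> x r"
  by (simp add: qball_def)

text \<open>Positivity is postulated for balls of doubled radius, so it is read off at half the
  radius.\<close>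

lemma emeasure_qball:
  assumes "0 < r"
  shows "0 < emeasure \<mu> (qball \<rho> x r)" "emeasure \<mu> (qball \<rho> x r) < top"
proof -
  have "0 < r / 2" using assms by simp
  then have "0 < emeasure \<mu> (qball \<rho> x (2 * (r / 2)))"
    using homogeneous unfolding homogeneous_type_def by blast
  then show "0 < emeasure \<mu> (qball \<rho> x r)" by simp
  show "emeasure \<mu> (qball \<rho> x r) < top"
    using homogeneous assms unfolding homogeneous_type_def by auto
qed

text \<open>Doubling is iterated until the power of 2 exceeds \<open>a\<close>. The maximum with 1
  provides the condition on the constant in \<open>frac_weight_comparable\<close>.\<close>

lemma qball_growth:
  "\<exists>K\<ge>1. \<forall>x r. 0 < r \<longrightarrow> emeasure \<mu> (qball \<rho> x (a * r)) \<le> ennreal K * emeasure \<mu> (qball \<rho> x r)"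
proof -
  obtain C where C: "0 < C"
    "\<And>x r. 0 < r \<Longrightarrow> emeasure \<mu> (qball \<rho> x (2 * r)) \<le> ennreal C * emeasure \<mu> (qball \<rho> x r)"
    using homogeneous unfolding homogeneous_type_def by blast
  have pow: "emeasure \<mu> (qball \<rho> x (2 ^ m * r)) \<le> ennreal (C ^ m) * emeasure \<mu> (qball \<rho> x r)"
    if "0 < r" for x r m
  proof (induction m)
    case (Suc m)
    have "emeasure \<mu> (qball \<rho> x (2 ^ Suc m * r)) \<le> ennreal C * emeasure \<mu> (qball \<rho> x (2 ^ m * r))"
      using C(2)[of "2 ^ m * r" x] that by (simp add: mult.assoc)
    also have "\<dots> \<le> ennreal C * (ennreal (C ^ m) * emeasure \<mu> (qball \<rho> x r))"
      by (intro mult_left_mono Suc) simp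
    finally show ?case
      using C by (simp add: ennreal_mult mult.assoc)
  qed simp
  obtain m where m: "a < 2 ^ m"
    using real_arch_pow[of 2 a] by auto
  have "emeasure \<mu> (qball \<rho> x (a * r)) \<le> ennreal (max 1 (C ^ m)) * emeasure \<mu> (qball \<rho> x r)"
    if "0 < r" for x r
  proof -
    have "emeasure \<mu> (qball \<rho> x (a * r)) \<le> emeasure \<mu> (qball \<rho> x (2 ^ m * r))"
      using m that by (intro emeasure_mono qball_mono) (auto simp: sets_\<mu> qball_borel)
    also note pow[OF that]
    also have "ennreal (C ^ m) * emeasure \<mu> (qball \<rho> x r) \<le> ennreal (max 1 (C ^ m)) * emeasure \<mu> (qball \<rho> x r)"
      by (intro mult_right_mono ennreal_leI) auto
    finally show ?thesis .
  qed
  then show ?thesis by (intro exI[of _ "max 1 (C ^ m)"]) auto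
qed

text \<open>Balls have positive finite measure, so the division becomes multiplication by a weight,
  which is convenient to compare between balls and cubes.\<close>

lemma frac_maximal_eq:
  "frac_maximal \<rho> \<mu> \<gamma> f x = (SUP (y, r) \<in> {(y, r). 0 < r}.
     indicator (qball \<rho> y r) x * (frac_weight \<mu> \<gamma> (qball \<rho> y r) * (\<integral>\<^sup>+w\<in>qball \<rho> y r. f w \<partial>\<mu>)))"
  unfolding frac_maximal_def
proof (rule SUP_cong, simp, clarsimp)
  fix y and r :: real assume "0 < r"
  define m where "m = measure \<mu> (qball \<rho> y r)"
  have m: "emeasure \<mu> (qball \<rho> y r) = ennreal m" "0 < m"
    using emeasure_qball[OF \<open>0 < r\<close>, of y]
    by (cases "emeasure \<mu> (qball \<rho> y r)"; simp add: m_def measure_def)+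
  have "indicator (qball \<rho> y r) x / enn_powr (emeasure \<mu> (qball \<rho> y r)) (1 - \<gamma>)
      = indicator (qball \<rho> y r) x * frac_weight \<mu> \<gamma> (qball \<rho> y r)"
    using m divide_ennreal[of 1 "m powr (1 - \<gamma>)"]
    by (auto simp: frac_weight_def m_def[symmetric] enn_powr_ennreal powr_diff indicator_def)
  then show "indicator (qball \<rho> y r) x / enn_powr (emeasure \<mu> (qball \<rho> y r)) (1 - \<gamma>) * (\<integral>\<^sup>+w\<in>qball \<rho> y r. f w \<partial>\<mu>)
      = indicator (qball \<rho> y r) x * (frac_weight \<mu> \<gamma> (qball \<rho> y r) * (\<integral>\<^sup>+w\<in>qball \<rho> y r. f w \<partial>\<mu>))"
    by (simp add: mult.assoc)
qed

lemma frac_maximal_ge: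
  assumes "0 < r" "x \<in> qball \<rho> y r"
  shows "frac_weight \<mu> \<gamma> (qball \<rho> y r) * (\<integral>\<^sup>+w\<in>qball \<rho> y r. f w \<partial>\<mu>) \<le> frac_maximal \<rho> \<mu> \<gamma> f x"
  unfolding frac_maximal_eq using assms by (intro SUP_upper2[of "(y, r)"]) auto

text \<open>A power with exponent \<open>\<gamma> - 1\<close> is decreasing in the measure. The
  resulting factor \<open>K powr (1 - \<gamma>)\<close> is at most \<open>K\<close> because
  \<open>K\<close> is at least 1 and the exponent at most 1.\<close>

lemma frac_weight_comparable:
  assumes "0 \<le> \<gamma>" "\<gamma> < 1" "1 \<le> K"
    and "0 < emeasure \<mu> A" "emeasure \<mu> A < top" "0 < emeasure \<mu> B" "emeasure \<mu> B < top"
    and le: "emeasure \<mu> B \<le> ennreal K * emeasure \<mu> A"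
  shows "frac_weight \<mu> \<gamma> A \<le> ennreal K * frac_weight \<mu> \<gamma> B"
proof -
  obtain a where a: "emeasure \<mu> A = ennreal a" "0 < a" "measure \<mu> A = a"
    using assms by (cases "emeasure \<mu> A") (auto simp: measure_def)
  obtain b where b: "emeasure \<mu> B = ennreal b" "0 < b" "measure \<mu> B = b"
    using assms by (cases "emeasure \<mu> B") (auto simp: measure_def)
  have "b \<le> K * a"
    using le a b assms by (simp add: ennreal_mult[symmetric])
  then have "(K * a) powr (\<gamma> - 1) \<le> b powr (\<gamma> - 1)"
    using b assms by (intro powr_mono2') auto
  then have "K powr (1 - \<gamma>) * (K powr (\<gamma> - 1) * a powr (\<gamma> - 1)) \<le> K powr (1 - \<gamma>) * b powr (\<gamma> - 1)"
    using assms a by (intro mult_left_mono) (auto simp: powr_mult)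
  also have "K powr (1 - \<gamma>) * (K powr (\<gamma> - 1) * a powr (\<gamma> - 1)) = a powr (\<gamma> - 1)"
    using assms by (simp add: mult.assoc[symmetric] powr_add[symmetric])
  also have "K powr (1 - \<gamma>) * b powr (\<gamma> - 1) \<le> K * b powr (\<gamma> - 1)"
    using assms powr_mono[of "1 - \<gamma>" 1 K] by (intro mult_right_mono) auto
  finally have "a powr (\<gamma> - 1) \<le> K * b powr (\<gamma> - 1)" .
  then show ?thesis
    using a b assms by (simp add: frac_weight_def ennreal_mult[symmetric])
qed

end

lemma countable_dyadic_cubes: "countable (dyadic_cubes L I Q)"
  unfolding dyadic_cubes_def by (intro countable_UN countable_image) auto

lemma Lq_norm_ennreal:
  assumes "0 < a" "h \<in> borel_measurable M"
  shows "Lq_norm M (ennreal a) h = enn_powr (\<integral>\<^sup>+x. enn_powr (h x) a \<partial>M) (1 / a)"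
  using assms by (simp add: Lq_norm_measurable Lq_norm_meas_def)

lemma ex_powi_between:
  fixes \<delta> r :: real
  assumes "0 < \<delta>" "\<delta> < 1" "0 < r"
  shows "\<exists>k. \<delta> powi (k + 2) < r \<and> r \<le> \<delta> powi (k + 1)"
proof -
  \<comment> \<open>As \<delta> is less than 1, its powers decrease in the exponent; the strict
    upper bound of the floor becomes the strict lower bound on \<open>r\<close>.\<close>
  define k where "k = \<lfloor>log \<delta> r\<rfloor> - 1"
  have "real_of_int (k + 1) \<le> log \<delta> r" "log \<delta> r < real_of_int (k + 2)"
    unfolding k_def by linarith+
  then have "\<delta> powr real_of_int (k + 2) < \<delta> powr log \<delta> r" "\<delta> powr log \<delta> r \<le> \<delta> powr real_of_int (k + 1)"
    using assms by (blast intro: powr_less_mono' powr_mono' less_imp_le)+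
  then show ?thesis
    using assms by (intro exI[of _ k]) (simp add: powr_real_of_int'[symmetric])
qed

lemma dyadic_systemD:
  assumes "dyadic_system \<rho> A0 \<delta> x0 I z Q"
  shows "\<alpha> \<in> I k \<Longrightarrow> Q k \<alpha> \<in> qborel_sets \<rho>"
    and "\<alpha> \<in> I k \<Longrightarrow> qball \<rho> (z k \<alpha>) (inverse (12 * A0 ^ 4) * \<delta> powi k) \<subseteq> Q k \<alpha>"
    and "\<alpha> \<in> I k \<Longrightarrow> Q k \<alpha> \<subseteq> qball \<rho> (z k \<alpha>) (4 * A0 ^ 2 * \<delta> powi k)"
    and "disjoint_family_on (Q k) (I k)"
    and "k \<le> l \<Longrightarrow> \<alpha> \<in> I k \<Longrightarrow> \<beta> \<in> I l \<Longrightarrow> Q l \<beta> \<subseteq> Q k \<alpha> \<or> Q k \<alpha> \<inter> Q l \<beta> = {}"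
proof -
  note * = assms[unfolded dyadic_system_def Let_def]
  show "\<alpha> \<in> I k \<Longrightarrow> Q k \<alpha> \<in> qborel_sets \<rho>"
    using *[THEN conjunct1] by blast
  show "disjoint_family_on (Q k) (I k)"
    using *[THEN conjunct2, THEN conjunct1] by blast
  show "k \<le> l \<Longrightarrow> \<alpha> \<in> I k \<Longrightarrow> \<beta> \<in> I l \<Longrightarrow> Q l \<beta> \<subseteq> Q k \<alpha> \<or> Q k \<alpha> \<inter> Q l \<beta> = {}"
    using *[THEN conjunct2, THEN conjunct2, THEN conjunct1] by blast
  note ** = *[THEN conjunct2, THEN conjunct2, THEN conjunct2, THEN conjunct1]
  show "\<alpha> \<in> I k \<Longrightarrow> qball \<rho> (z k \<alpha>) (inverse (12 * A0 ^ 4) * \<delta> powi k) \<subseteq> Q k \<alpha>"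
    and "\<alpha> \<in> I k \<Longrightarrow> Q k \<alpha> \<subseteq> qball \<rho> (z k \<alpha>) (4 * A0 ^ 2 * \<delta> powi k)"
    using ** by blast+
qed

section \<open>Two-sided comparison of balls with dyadic cubes\<close>

context homogeneous_space
begin

text \<open>A cube lies between two concentric balls whose radii have the ratio
  \<open>4 * A0 ^ 2 * (12 * A0 ^ 4) = 48 * A0 ^ 6\<close>, so doubling compares the measures. The
  constant is chosen before the systems, which makes it uniform over them.\<close>

lemma cube_in_ball:
  assumes \<delta>: "0 < \<delta>"
  shows "\<exists>K\<ge>1. \<forall>L x0 I z Q S. adjacent_dyadic_systems \<rho> A0 \<delta> L x0 I z Q \<longrightarrow> S \<in> dyadic_cubes L I Q \<longrightarrow>
    S \<in> qborel_sets \<rho> \<and> 0 < emeasure \<mu> S \<and> emeasure \<mu> S < top \<and>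
    (\<exists>y r. 0 < r \<and> S \<subseteq> qball \<rho> y r \<and> emeasure \<mu> (qball \<rho> y r) \<le> ennreal K * emeasure \<mu> S)"
proof -
  have A0: "0 < A0" using A0_ge_1 by simp
  obtain K where K: "1 \<le> K" "\<And>x r. 0 < r \<Longrightarrow>
      emeasure \<mu> (qball \<rho> x (48 * A0 ^ 6 * r)) \<le> ennreal K * emeasure \<mu> (qball \<rho> x r)"
    using qball_growth[of "48 * A0 ^ 6"] by blast
  have "S \<in> qborel_sets \<rho> \<and> 0 < emeasure \<mu> S \<and> emeasure \<mu> S < top \<and>
    (\<exists>y r. 0 < r \<and> S \<subseteq> qball \<rho> y r \<and> emeasure \<mu> (qball \<rho> y r) \<le> ennreal K * emeasure \<mu> S)"
    if sys: "adjacent_dyadic_systems \<rho> A0 \<delta> L x0 I z Q" and S: "S \<in> dyadic_cubes L I Q" for L x0 I z Q S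
  proof -
    from S obtain t k \<alpha> where t: "t \<in> {1..L}" "\<alpha> \<in> I t k" "S = Q t k \<alpha>"
      by (auto simp: dyadic_cubes_def)
    with sys have ds: "dyadic_system \<rho> A0 \<delta> x0 (I t) (z t) (Q t)"
      by (simp add: adjacent_dyadic_systems_def)
    define r where "r = inverse (12 * A0 ^ 4) * \<delta> powi k"
    define R where "R = 4 * A0 ^ 2 * \<delta> powi k"
    have r: "0 < r" "R = 48 * A0 ^ 6 * r" "0 < R"
      using \<delta> A0 by (auto simp: r_def R_def field_simps power_add[symmetric])
    have S: "S \<in> qborel_sets \<rho>" "qball \<rho> (z t k \<alpha>) r \<subseteq> S" "S \<subseteq> qball \<rho> (z t k \<alpha>) R"
      using dyadic_systemD(1-3)[OF ds t(2)] t(3) by (simp_all add: r_def R_def)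
    have S': "S \<in> sets \<mu>" using S sets_\<mu> by simp
    have "emeasure \<mu> (qball \<rho> (z t k \<alpha>) r) \<le> emeasure \<mu> S"
      using S S' by (intro emeasure_mono)
    moreover have "emeasure \<mu> S \<le> emeasure \<mu> (qball \<rho> (z t k \<alpha>) R)"
      using S by (intro emeasure_mono) (auto simp: sets_\<mu> qball_borel)
    moreover have "emeasure \<mu> (qball \<rho> (z t k \<alpha>) R) \<le> ennreal K * emeasure \<mu> (qball \<rho> (z t k \<alpha>) r)"
      using K(2) r by simp
    ultimately have "0 < emeasure \<mu> S" "emeasure \<mu> S < top"
      and "emeasure \<mu> (qball \<rho> (z t k \<alpha>) R) \<le> ennreal K * emeasure \<mu> S"
      using emeasure_qball(1)[OF r(1), of "z t k \<alpha>"] emeasure_qball(2)[OF r(3), of "z t k \<alpha>"]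
        mult_left_mono[of "emeasure \<mu> (qball \<rho> (z t k \<alpha>) r)" "emeasure \<mu> S" "ennreal K"]
      by auto
    then show ?thesis using S r by blast
  qed
  with K(1) show ?thesis by blast
qed

text \<open>The cube supplied by the adjacent systems has diameter at most a multiple
  \<open>a\<close> of \<open>r\<close> and contains the center \<open>y\<close>, so it stays in a
  dilated ball. The dilation \<open>a + 1\<close> turns the weak diameter bound into the strict
  inequality defining a ball.\<close>

lemma ball_in_cube:
  assumes \<delta>: "0 < \<delta>" "\<delta> < 1"
  shows "\<exists>K\<ge>1. \<forall>L x0 I z Q y r. adjacent_dyadic_systems \<rho> A0 \<delta> L x0 I z Q \<longrightarrow> 0 < r \<longrightarrow>
    (\<exists>S\<in>dyadic_cubes L I Q. qball \<rho> y r \<subseteq> S \<and> emeasure \<mu> S \<le> ennreal K * emeasure \<mu> (qball \<rho> y r))"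
proof -
  define a where "a = 8 * A0 ^ 3 * \<delta> powi (-2)"
  obtain K where K: "1 \<le> K" "\<And>x r. 0 < r \<Longrightarrow>
      emeasure \<mu> (qball \<rho> x ((a + 1) * r)) \<le> ennreal K * emeasure \<mu> (qball \<rho> x r)"
    using qball_growth[of "a + 1"] by blast
  have "\<exists>S\<in>dyadic_cubes L I Q. qball \<rho> y r \<subseteq> S \<and> emeasure \<mu> S \<le> ennreal K * emeasure \<mu> (qball \<rho> y r)"
    if sys: "adjacent_dyadic_systems \<rho> A0 \<delta> L x0 I z Q" and r: "0 < r" for L x0 I z Q y r
  proof -
    obtain k where "\<delta> powi (k + 2) < r \<and> r \<le> \<delta> powi (k + 1)"
      using ex_powi_between[OF \<delta> r] by blast
    then obtain t \<alpha> where t: "t \<in> {1..L}" "\<alpha> \<in> I t k" "qball \<rho> y r \<subseteq> Q t k \<alpha>"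
      "qdiam \<rho> (Q t k \<alpha>) \<le> ennreal (a * r)"
      using sys unfolding adjacent_dyadic_systems_def a_def by blast
    have "Q t k \<alpha> \<subseteq> qball \<rho> y ((a + 1) * r)"
    proof
      fix w assume w: "w \<in> Q t k \<alpha>"
      have "y \<in> Q t k \<alpha>" using t(3) center_in_qball[OF r] by blast
      with w have "ennreal (\<rho> w y) \<le> qdiam \<rho> (Q t k \<alpha>)"
        unfolding qdiam_def by (intro SUP_upper2[of w] SUP_upper2[of y]) auto
      with t(4) have "ennreal (\<rho> w y) \<le> ennreal (a * r)" by (rule order_trans[rotated])
      moreover have "0 \<le> a * r" using A0_ge_1 \<delta> r by (simp add: a_def)
      ultimately have "\<rho> w y \<le> a * r" by simp
      then show "w \<in> qball \<rho> y ((a + 1) * r)" using r by (simp add: qball_def distrib_right)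
    qed
    then have "emeasure \<mu> (Q t k \<alpha>) \<le> emeasure \<mu> (qball \<rho> y ((a + 1) * r))"
      by (intro emeasure_mono) (auto simp: sets_\<mu> qball_borel)
    with K(2)[OF r, of y] have "emeasure \<mu> (Q t k \<alpha>) \<le> ennreal K * emeasure \<mu> (qball \<rho> y r)"
      by simp
    moreover have "Q t k \<alpha> \<in> dyadic_cubes L I Q" using t(1,2) unfolding dyadic_cubes_def by blast
    ultimately show ?thesis using t by blast
  qed
  with K(1) show ?thesis by blast
qed

text \<open>The cube is enlarged to a ball of comparable measure, which again contains
  \<open>x\<close>.\<close>

lemma cube_average_le_frac_maximal:
  assumes "0 < \<delta>" "0 \<le> \<gamma>" "\<gamma> < 1"
  shows "\<exists>K\<ge>1. \<forall>L x0 I z Q S f x. adjacent_dyadic_systems \<rho> A0 \<delta> L x0 I z Q \<longrightarrow>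
    S \<in> dyadic_cubes L I Q \<longrightarrow> x \<in> S \<longrightarrow>
    frac_weight \<mu> \<gamma> S * (\<integral>\<^sup>+w\<in>S. f w \<partial>\<mu>) \<le> ennreal K * frac_maximal \<rho> \<mu> \<gamma> f x"
proof -
  obtain K where K: "1 \<le> K"
    "\<And>L x0 I z Q S. adjacent_dyadic_systems \<rho> A0 \<delta> L x0 I z Q \<Longrightarrow> S \<in> dyadic_cubes L I Q \<Longrightarrow>
    S \<in> qborel_sets \<rho> \<and> 0 < emeasure \<mu> S \<and> emeasure \<mu> S < top \<and>
    (\<exists>y r. 0 < r \<and> S \<subseteq> qball \<rho> y r \<and> emeasure \<mu> (qball \<rho> y r) \<le> ennreal K * emeasure \<mu> S)"
    using cube_in_ball[OF assms(1)] by blast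
  have "frac_weight \<mu> \<gamma> S * (\<integral>\<^sup>+w\<in>S. f w \<partial>\<mu>) \<le> ennreal K * frac_maximal \<rho> \<mu> \<gamma> f x"
    if sys: "adjacent_dyadic_systems \<rho> A0 \<delta> L x0 I z Q" and S: "S \<in> dyadic_cubes L I Q" "x \<in> S"
    for L x0 I z Q S x and f :: "'a \<Rightarrow> ennreal"
  proof -
    obtain y r where yr: "0 < r" "S \<subseteq> qball \<rho> y r" "emeasure \<mu> (qball \<rho> y r) \<le> ennreal K * emeasure \<mu> S"
      and S': "0 < emeasure \<mu> S" "emeasure \<mu> S < top"
      using K(2)[OF sys S(1)] by blast
    have "frac_weight \<mu> \<gamma> S \<le> ennreal K * frac_weight \<mu> \<gamma> (qball \<rho> y r)"
      by (rule frac_weight_comparable) (use assms K S' yr emeasure_qball[OF yr(1), of y] in auto)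
    then have "frac_weight \<mu> \<gamma> S * (\<integral>\<^sup>+w\<in>S. f w \<partial>\<mu>)
        \<le> (ennreal K * frac_weight \<mu> \<gamma> (qball \<rho> y r)) * (\<integral>\<^sup>+w\<in>qball \<rho> y r. f w \<partial>\<mu>)"
      using yr(2) by (intro mult_mono nn_integral_mono) (auto simp: indicator_def)
    also have "\<dots> \<le> ennreal K * frac_maximal \<rho> \<mu> \<gamma> f x"
      using frac_maximal_ge[OF yr(1), of x y] yr(2) S(2)
      by (auto simp: mult.assoc intro!: mult_left_mono)
    finally show ?thesis .
  qed
  with K(1) show ?thesis by blast
qed

text \<open>The opposite enlargement, from a ball to a cube of comparable measure. It replaces the
  supremum over uncountably many balls by one over countably many cubes.\<close>

lemma frac_maximal_le_cube_average:
  assumes "0 < \<delta>" "\<delta> < 1" "0 \<le> \<gamma>" "\<gamma> < 1"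
  shows "\<exists>K\<ge>1. \<forall>L x0 I z Q f x. adjacent_dyadic_systems \<rho> A0 \<delta> L x0 I z Q \<longrightarrow>
    frac_maximal \<rho> \<mu> \<gamma> f x \<le> ennreal K *
      (SUP S\<in>dyadic_cubes L I Q. indicator S x * (frac_weight \<mu> \<gamma> S * (\<integral>\<^sup>+w\<in>S. f w \<partial>\<mu>)))"
proof -
  obtain K where K: "1 \<le> K"
    "\<And>L x0 I z Q y r. adjacent_dyadic_systems \<rho> A0 \<delta> L x0 I z Q \<Longrightarrow> 0 < r \<Longrightarrow>
    (\<exists>S\<in>dyadic_cubes L I Q. qball \<rho> y r \<subseteq> S \<and> emeasure \<mu> S \<le> ennreal K * emeasure \<mu> (qball \<rho> y r))"
    using ball_in_cube[OF assms(1,2)] by blast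
  have "frac_maximal \<rho> \<mu> \<gamma> f x \<le> ennreal K *
      (SUP S\<in>dyadic_cubes L I Q. indicator S x * (frac_weight \<mu> \<gamma> S * (\<integral>\<^sup>+w\<in>S. f w \<partial>\<mu>)))"
    (is "_ \<le> ?rhs")
    if sys: "adjacent_dyadic_systems \<rho> A0 \<delta> L x0 I z Q" for L x0 I z Q x and f :: "'a \<Rightarrow> ennreal"
    unfolding frac_maximal_eq
  proof (intro SUP_least, clarify)
    fix y and r :: real assume r: "0 < r"
    obtain S where S: "S \<in> dyadic_cubes L I Q" "qball \<rho> y r \<subseteq> S" "emeasure \<mu> S \<le> ennreal K * emeasure \<mu> (qball \<rho> y r)"
      using K(2)[OF sys r] by blast
    have S': "0 < emeasure \<mu> S" "emeasure \<mu> S < top" "S \<in> sets \<mu>"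
      using cube_in_ball[OF assms(1)] sys S(1) sets_\<mu> by blast+
    have "frac_weight \<mu> \<gamma> (qball \<rho> y r) \<le> ennreal K * frac_weight \<mu> \<gamma> S"
      by (rule frac_weight_comparable) (use assms K S' S emeasure_qball[OF r, of y] in auto)
    then have "indicator (qball \<rho> y r) x * (frac_weight \<mu> \<gamma> (qball \<rho> y r) * (\<integral>\<^sup>+w\<in>qball \<rho> y r. f w \<partial>\<mu>))
      \<le> indicator S x * ((ennreal K * frac_weight \<mu> \<gamma> S) * (\<integral>\<^sup>+w\<in>S. f w \<partial>\<mu>))"
      using S(2) by (intro mult_mono nn_integral_mono) (auto simp: indicator_def)
    also have "\<dots> = ennreal K * (indicator S x * (frac_weight \<mu> \<gamma> S * (\<integral>\<^sup>+w\<in>S. f w \<partial>\<mu>)))"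
      by (simp add: ac_simps)
    also have "\<dots> \<le> ?rhs"
      using S(1) by (intro mult_left_mono SUP_upper) auto
    finally show "indicator (qball \<rho> y r) x * (frac_weight \<mu> \<gamma> (qball \<rho> y r) * (\<integral>\<^sup>+w\<in>qball \<rho> y r. f w \<partial>\<mu>)) \<le> ?rhs" .
  qed
  with K(1) show ?thesis by blast
qed

end

section \<open>The dual weight\<close>

locale dual_weight = homogeneous_space +
  fixes \<sigma> :: "'a measure" and p :: real
  assumes sets_\<sigma>: "sets \<sigma> = qborel_sets \<rho>"
    and sigma_finite_\<sigma>: "sigma_finite_measure \<sigma>"
    and p_gt_1: "1 < p"
begin

lemma sets_eq [measurable_cong]: "sets \<sigma> = sets \<mu>"
  using sets_\<sigma> sets_\<mu> by simp

lemma sigma_finite_\<mu>: "sigma_finite_measure \<mu>"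
proof
  fix x :: 'a
  show "\<exists>A. countable A \<and> A \<subseteq> sets \<mu> \<and> \<Union>A = space \<mu> \<and> (\<forall>a\<in>A. emeasure \<mu> a \<noteq> \<infinity>)"
  proof (intro exI conjI ballI)
    let ?A = "range (\<lambda>n. qball \<rho> x (real (Suc n)))"
    show "?A \<subseteq> sets \<mu>" by (auto simp: sets_\<mu> qball_borel)
    have "\<exists>n. \<rho> y x < real (Suc n)" for y
      using reals_Archimedean2[of "\<rho> y x"] by (metis less_trans lessI of_nat_less_iff)
    then show "\<Union>?A = space \<mu>"
      by (auto simp: space_eq_UNIV[OF sets_\<mu>] qball_def)
    show "emeasure \<mu> a \<noteq> \<infinity>" if "a \<in> ?A" for a
      using that emeasure_qball(2)[of "real (Suc _)" x] by (auto simp: less_top[symmetric])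
  qed auto
qed

definition dual :: "'a \<Rightarrow> ennreal" where
  "dual x = enn_powr (RN_deriv \<sigma> \<mu> x) (1 / (p - 1))"

definition \<nu> :: "'a measure" where
  "\<nu> = density \<mu> dual"

lemma dual_measurable [measurable]: "dual \<in> borel_measurable \<mu>"
  unfolding dual_def using borel_measurable_RN_deriv[of \<sigma> \<mu>] by measurable

lemma sets_\<nu> [simp, measurable_cong]: "sets \<nu> = sets \<mu>"
  by (simp add: \<nu>_def)

lemma testing_weight_eq: "testing_weight \<mu> \<sigma> p S x = indicator S x * dual x"
  by (simp add: testing_weight_def dual_def)

text \<open>The identity \<open>p / (p - 1) = 1 + 1 / (p - 1)\<close>: it turns p-th powers of the
  dual weight integrated against \<sigma> into first powers integrated against \<mu>.\<close>

lemma enn_powr_dual: "enn_powr (dual x) p = RN_deriv \<sigma> \<mu> x * dual x"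
proof -
  have "1 / (p - 1) * p = 1 + 1 / (p - 1)" using p_gt_1 by (simp add: field_simps)
  then show ?thesis
    using p_gt_1 by (simp add: dual_def enn_powr_powr enn_powr_one_plus)
qed

end

locale dual_weight_ac = dual_weight +
  assumes ac: "absolutely_continuous \<sigma> \<mu>"
begin

lemma nn_integral_\<mu>:
  assumes "f \<in> borel_measurable \<mu>"
  shows "(\<integral>\<^sup>+x. f x \<partial>\<mu>) = (\<integral>\<^sup>+x. RN_deriv \<sigma> \<mu> x * f x \<partial>\<sigma>)"
proof -
  have "f \<in> borel_measurable \<sigma>" using assms by measurable
  then show ?thesis
    using sigma_finite_measure.RN_deriv_nn_integral[OF sigma_finite_\<sigma> ac] sets_eq by simp
qed

lemma AE_RN_finite: "AE x in \<sigma>. RN_deriv \<sigma> \<mu> x \<noteq> top"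
  using sigma_finite_measure.RN_deriv_finite[OF sigma_finite_\<sigma> sigma_finite_\<mu> ac] sets_eq by simp

text \<open>The zero set of \<open>dual\<close> is \<mu>-null because the Radon-Nikodym derivative
  is a density of \<mu>; the derivative is infinite only on a \<sigma>-null set.\<close>

lemma AE_dual: "AE x in \<mu>. dual x \<noteq> 0 \<and> dual x \<noteq> top"
proof -
  have \<mu>: "\<mu> = density \<sigma> (RN_deriv \<sigma> \<mu>)"
    using sigma_finite_measure.density_RN_deriv[OF sigma_finite_\<sigma> ac] sets_eq by simp
  have "AE x in density \<sigma> (RN_deriv \<sigma> \<mu>). dual x \<noteq> 0 \<and> dual x \<noteq> top"
    using AE_RN_finite by (subst AE_density) (auto simp: dual_def)
  then show ?thesis unfolding \<mu>[symmetric] .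
qed

lemma Lq_norm_testing_weight:
  assumes "S \<in> sets \<mu>"
  shows "Lq_norm \<sigma> (ennreal p) (testing_weight \<mu> \<sigma> p S) = enn_powr (emeasure \<nu> S) (1 / p)"
proof -
  note [measurable] = assms
  have "testing_weight \<mu> \<sigma> p S \<in> borel_measurable \<sigma>"
    unfolding testing_weight_eq[abs_def] by measurable
  then have "Lq_norm \<sigma> (ennreal p) (testing_weight \<mu> \<sigma> p S)
      = enn_powr (\<integral>\<^sup>+x. enn_powr (testing_weight \<mu> \<sigma> p S x) p \<partial>\<sigma>) (1 / p)"
    using p_gt_1 by (intro Lq_norm_ennreal) auto
  also have "(\<integral>\<^sup>+x. enn_powr (testing_weight \<mu> \<sigma> p S x) p \<partial>\<sigma>)
      = (\<integral>\<^sup>+x. RN_deriv \<sigma> \<mu> x * (dual x * indicator S x) \<partial>\<sigma>)"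
    by (intro nn_integral_cong) (auto simp: testing_weight_eq enn_powr_dual indicator_def)
  also have "\<dots> = (\<integral>\<^sup>+x. dual x * indicator S x \<partial>\<mu>)"
    by (rule nn_integral_\<mu>[symmetric]) measurable
  also have "\<dots> = emeasure \<nu> S"
    unfolding \<nu>_def by (simp add: emeasure_density)
  finally show ?thesis .
qed

text \<open>The density of \<nu> cancels the division \<mu>-almost everywhere, since
  \<open>dual\<close> is there neither zero nor infinite.\<close>

lemma set_nn_integral_\<nu>_quotient:
  assumes [measurable]: "F \<in> borel_measurable \<mu>" "S \<in> sets \<mu>"
  shows "(\<integral>\<^sup>+x\<in>S. F x / dual x \<partial>\<nu>) = (\<integral>\<^sup>+x\<in>S. F x \<partial>\<mu>)"
proof -
  have "(\<integral>\<^sup>+x\<in>S. F x / dual x \<partial>\<nu>) = (\<integral>\<^sup>+x. dual x * (F x / dual x * indicator S x) \<partial>\<mu>)"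
    unfolding \<nu>_def by (subst nn_integral_density) auto
  also have "\<dots> = (\<integral>\<^sup>+x\<in>S. F x \<partial>\<mu>)"
  proof (rule nn_integral_cong_AE)
    show "AE x in \<mu>. dual x * (F x / dual x * indicator S x) = F x * indicator S x"
      using AE_dual
    proof eventually_elim
      case (elim x)
      then have "dual x * (F x / dual x) = F x"
        by (metis ennreal_times_divide mult.commute mult_divide_eq_ennreal)
      then show ?case by (simp add: mult.assoc[symmetric])
    qed
  qed
  finally show ?thesis .
qed

text \<open>An inequality is obtained because the product of \<open>dual x\<close> and
  \<open>F x / dual x\<close> is 0 instead of \<open>F x\<close> where \<open>dual\<close> is 0 or
  infinite; elsewhere the integrands agree.\<close>

lemma nn_integral_\<nu>_quotient_powr_le:
  assumes [measurable]: "F \<in> borel_measurable \<mu>"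
  shows "(\<integral>\<^sup>+x. enn_powr (F x / dual x) p \<partial>\<nu>) \<le> (\<integral>\<^sup>+x. enn_powr (F x) p \<partial>\<sigma>)"
proof -
  have "(\<integral>\<^sup>+x. enn_powr (F x / dual x) p \<partial>\<nu>) = (\<integral>\<^sup>+x. dual x * enn_powr (F x / dual x) p \<partial>\<mu>)"
    unfolding \<nu>_def by (subst nn_integral_density) auto
  also have "\<dots> = (\<integral>\<^sup>+x. RN_deriv \<sigma> \<mu> x * (dual x * enn_powr (F x / dual x) p) \<partial>\<sigma>)"
    by (rule nn_integral_\<mu>) measurable
  also have "\<dots> \<le> (\<integral>\<^sup>+x. enn_powr (F x) p \<partial>\<sigma>)"
  proof (intro nn_integral_mono)
    fix x
    have "RN_deriv \<sigma> \<mu> x * (dual x * enn_powr (F x / dual x) p) = enn_powr (dual x * (F x / dual x)) p"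
      using p_gt_1 by (simp add: enn_powr_mult enn_powr_dual mult.assoc)
    also have "dual x * (F x / dual x) \<le> F x"
    proof (cases "dual x = 0 \<or> dual x = top")
      case False
      then have "dual x * (F x / dual x) = F x"
        by (metis ennreal_times_divide mult.commute mult_divide_eq_ennreal)
      then show ?thesis by simp
    qed (auto simp: ennreal_mult_top)
    then have "enn_powr (dual x * (F x / dual x)) p \<le> enn_powr (F x) p"
      using p_gt_1 by (intro enn_powr_mono) auto
    finally show "RN_deriv \<sigma> \<mu> x * (dual x * enn_powr (F x / dual x) p) \<le> enn_powr (F x) p" .
  qed
  finally show ?thesis .
qed

end

text \<open>Hoelder's inequality with the constant 2. It follows from splitting \<open>g\<close> at
  a height \<open>t\<close>: below it \<open>g\<close> is at most \<open>t\<close>, above it at most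
  \<open>t powr (1 - p)\<close> times its p-th power.\<close>

lemma set_nn_integral_le_powr:
  assumes p: "1 < p" and [measurable]: "g \<in> borel_measurable M" "S \<in> sets M"
    and fin: "emeasure M S < top" "(\<integral>\<^sup>+x. enn_powr (g x) p \<partial>M) < top"
  shows "(\<integral>\<^sup>+x\<in>S. g x \<partial>M)
    \<le> 2 * enn_powr (\<integral>\<^sup>+x. enn_powr (g x) p \<partial>M) (1 / p) * enn_powr (emeasure M S) (1 - 1 / p)"
proof -
  obtain G where G: "(\<integral>\<^sup>+x. enn_powr (g x) p \<partial>M) = ennreal G" "0 \<le> G"
    using fin(2) by (cases "\<integral>\<^sup>+x. enn_powr (g x) p \<partial>M") auto
  obtain v where v: "emeasure M S = ennreal v" "0 \<le> v"
    using fin(1) by (cases "emeasure M S") auto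
  consider "v = 0" | "G = 0" | "0 < v" "0 < G" using G v by linarith
  then show ?thesis
  proof cases
    case 1
    then have "S \<in> null_sets M" using v by auto
    then show ?thesis by (simp add: nn_integral_null_set)
  next
    case 2
    then have "(\<integral>\<^sup>+x. enn_powr (g x) p \<partial>M) = 0" using G by simp
    then have "AE x in M. g x = 0"
      by (subst (asm) nn_integral_0_iff_AE) auto
    then have "(\<integral>\<^sup>+x\<in>S. g x \<partial>M) = 0"
      by (subst nn_integral_0_iff_AE) auto
    then show ?thesis by simp
  next
    case 3
    \<comment> \<open>This height balances the two parts: both integrate to
      \<open>G powr (1 / p) * v powr (1 - 1 / p)\<close>.\<close>
    define t where "t = (G / v) powr (1 / p)"
    have t: "0 < t" using 3 by (simp add: t_def)
    have "g x \<le> ennreal t + ennreal (t powr (1 - p)) * enn_powr (g x) p" for x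
    proof (cases "g x")
      case (real y)
      have "y \<le> t + t powr (1 - p) * y powr p"
      proof (cases "y \<le> t")
        case False
        then have "y = y powr (1 - p) * y powr p"
          using t by (simp add: powr_add[symmetric])
        also have "\<dots> \<le> t powr (1 - p) * y powr p"
          using False t p by (intro mult_right_mono powr_mono2') auto
        finally show ?thesis using t by simp
      qed (simp add: add_increasing2)
      then show ?thesis
        using real t by (simp add: enn_powr_ennreal ennreal_mult[symmetric] ennreal_plus[symmetric] del: ennreal_plus)
    qed (use t in \<open>simp add: ennreal_mult_top\<close>)
    then have "(\<integral>\<^sup>+x\<in>S. g x \<partial>M)
        \<le> (\<integral>\<^sup>+x. ennreal t * indicator S x + ennreal (t powr (1 - p)) * enn_powr (g x) p \<partial>M)"
      by (intro nn_integral_mono) (auto simp: indicator_def)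
    also have "\<dots> = ennreal t * ennreal v + ennreal (t powr (1 - p)) * ennreal G"
      by (subst nn_integral_add) (auto simp: nn_integral_cmult_indicator nn_integral_cmult G v)
    also have "\<dots> = ennreal (t * v + t powr (1 - p) * G)"
      using t G v by (simp add: ennreal_mult)
    also have "t * v = G powr (1 / p) * v powr (1 - 1 / p)"
      using 3 by (simp add: t_def powr_divide powr_diff)
    also have "t powr (1 - p) * G = G powr (1 / p) * v powr (1 - 1 / p)"
    proof -
      have e: "1 / p * (1 - p) = 1 / p - 1" using p by (simp add: field_simps)
      show ?thesis
        using 3 unfolding t_def powr_powr e by (simp add: powr_divide powr_diff)
    qed
    also have "ennreal (G powr (1 / p) * v powr (1 - 1 / p) + G powr (1 / p) * v powr (1 - 1 / p))
        = 2 * enn_powr (ennreal G) (1 / p) * enn_powr (ennreal v) (1 - 1 / p)"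
      using 3 by (subst ennreal_plus) (auto simp: enn_powr_ennreal ennreal_mult mult.assoc mult_2[symmetric])
    finally show ?thesis using G v by simp
  qed
qed

section \<open>Reduction of the testing and strong type conditions to suprema over cubes\<close>

context dual_weight_ac
begin

text \<open>On cubes inside \<open>R\<close> the testing weight coincides with \<open>dual\<close>,
  so \<open>u\<close> is a minorant of the localized maximal function, with \<open>1 / K\<close>
  absorbing the comparison of cubes with balls. It is measurable as a countable supremum, hence lies
  below every measurable majorant in the outer norm.\<close>

lemma testing_cube:
  assumes sets_\<omega>: "sets \<omega> = qborel_sets \<rho>"
    and \<D>: "countable \<D>" "\<D> \<subseteq> sets \<mu>"
    and K: "0 < K" "\<And>P x f. P \<in> \<D> \<Longrightarrow> x \<in> P \<Longrightarrow>
      frac_weight \<mu> \<gamma> P * (\<integral>\<^sup>+w\<in>P. f w \<partial>\<mu>) \<le> ennreal K * frac_maximal \<rho> \<mu> \<gamma> f x"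
    and testing: "testing_constant \<rho> \<mu> \<gamma> p q \<sigma> \<omega> \<D> N1" and R: "R \<in> \<D>"
  defines "u \<equiv> \<lambda>x. SUP P\<in>{P \<in> \<D>. P \<subseteq> R}. indicator P x * (frac_weight \<mu> \<gamma> P / ennreal K * emeasure \<nu> P)"
  shows "emeasure \<nu> R < top"
    and "u \<in> borel_measurable \<omega>"
    and "Lq_norm_meas \<omega> q u \<le> N1 * enn_powr (emeasure \<nu> R) (1 / p)"
proof -
  have norm: "Lq_norm \<sigma> (ennreal p) (testing_weight \<mu> \<sigma> p R) = enn_powr (emeasure \<nu> R) (1 / p)"
    using R \<D> by (intro Lq_norm_testing_weight) auto
  have le: "Lq_norm \<omega> q (\<lambda>x. indicator R x * frac_maximal \<rho> \<mu> \<gamma> (testing_weight \<mu> \<sigma> p R) x)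
      \<le> N1 * enn_powr (emeasure \<nu> R) (1 / p)"
    and fin: "enn_powr (emeasure \<nu> R) (1 / p) < top"
    using testing R unfolding testing_constant_def norm[symmetric] by auto
  show "emeasure \<nu> R < top" using fin by (cases "emeasure \<nu> R = top") (auto simp: top.not_eq_extremum)
  have [measurable]: "P \<in> sets \<omega>" if "P \<in> \<D>" for P
    using that \<D> sets_\<omega> sets_\<mu> by auto
  show u_meas: "u \<in> borel_measurable \<omega>"
    unfolding u_def using \<D>(1)
    by (intro borel_measurable_SUP) (auto intro!: borel_measurable_times borel_measurable_indicator)
  have u_le: "u x \<le> indicator R x * frac_maximal \<rho> \<mu> \<gamma> (testing_weight \<mu> \<sigma> p R) x" for x
    unfolding u_def
  proof (rule SUP_least)
    fix P assume P: "P \<in> {P \<in> \<D>. P \<subseteq> R}"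
    show "indicator P x * (frac_weight \<mu> \<gamma> P / ennreal K * emeasure \<nu> P)
        \<le> indicator R x * frac_maximal \<rho> \<mu> \<gamma> (testing_weight \<mu> \<sigma> p R) x"
    proof (cases "x \<in> P")
      case True
      have "P \<in> sets \<mu>" using P \<D> by auto
      then have "emeasure \<nu> P = (\<integral>\<^sup>+w\<in>P. dual w \<partial>\<mu>)"
        unfolding \<nu>_def by (simp add: emeasure_density)
      also have "\<dots> = (\<integral>\<^sup>+w\<in>P. testing_weight \<mu> \<sigma> p R w \<partial>\<mu>)"
        using P by (intro nn_integral_cong) (auto simp: testing_weight_eq indicator_def)
      finally have "frac_weight \<mu> \<gamma> P * emeasure \<nu> P
          \<le> ennreal K * frac_maximal \<rho> \<mu> \<gamma> (testing_weight \<mu> \<sigma> p R) x"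
        using K(2)[of P x] P True by simp
      then have "frac_weight \<mu> \<gamma> P * emeasure \<nu> P / ennreal K
          \<le> frac_maximal \<rho> \<mu> \<gamma> (testing_weight \<mu> \<sigma> p R) x"
        using K(1) by (intro divide_le_posI_ennreal) (auto simp: ac_simps)
      then show ?thesis
        using True P by (auto simp: ennreal_times_divide ac_simps)
    qed simp
  qed
  have "Lq_norm_meas \<omega> q u \<le> Lq_norm \<omega> q (\<lambda>x. indicator R x * frac_maximal \<rho> \<mu> \<gamma> (testing_weight \<mu> \<sigma> p R) x)"
    unfolding Lq_norm_def
  proof (rule INF_greatest)
    fix h assume "h \<in> {h \<in> borel_measurable \<omega>. (\<lambda>x. indicator R x * frac_maximal \<rho> \<mu> \<gamma> (testing_weight \<mu> \<sigma> p R) x) \<le> h}"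
    then show "Lq_norm_meas \<omega> q u \<le> Lq_norm_meas \<omega> q h"
      using u_meas u_le by (intro Lq_norm_meas_mono) (auto simp: le_fun_def intro: order_trans)
  qed
  with le show "Lq_norm_meas \<omega> q u \<le> N1 * enn_powr (emeasure \<nu> R) (1 / p)" by simp
qed

text \<open>The supremum over cubes is a measurable majorant of the maximal function, so its norm
  bounds the outer norm. The quotient by \<open>K\<close>, compensated by the factor
  \<open>K\<close> outside, gives the cubes the same weights as in \<open>testing_cube\<close>. The
  function \<open>g\<close> is the absolute value of \<open>f\<close> divided by the dual
  weight.\<close>

lemma strong_type_constantI:
  assumes sets_\<omega>: "sets \<omega> = qborel_sets \<rho>"
    and \<D>: "countable \<D>" "\<D> \<subseteq> sets \<mu>"
    and K: "0 < K"
    and dom: "\<And>f x. frac_maximal \<rho> \<mu> \<gamma> f x \<le> ennreal K' *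
      (SUP S\<in>\<D>. indicator S x * (frac_weight \<mu> \<gamma> S * (\<integral>\<^sup>+w\<in>S. f w \<partial>\<mu>)))"
    and N: "N < \<infinity>"
    and bound: "\<And>g. g \<in> borel_measurable \<nu> \<Longrightarrow> (\<integral>\<^sup>+x. enn_powr (g x) p \<partial>\<nu>) < top \<Longrightarrow>
      Lq_norm_meas \<omega> q (\<lambda>x. ennreal (K' * K) * (SUP S\<in>\<D>. indicator S x * (frac_weight \<mu> \<gamma> S / ennreal K * (\<integral>\<^sup>+w\<in>S. g w \<partial>\<nu>))))
      \<le> N * enn_powr (\<integral>\<^sup>+x. enn_powr (g x) p \<partial>\<nu>) (1 / p)"
    and K': "0 \<le> K'"
  shows "strong_type_constant \<rho> \<mu> \<gamma> p q \<sigma> \<omega> N"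
  unfolding strong_type_constant_def
proof (intro conjI allI impI N)
  fix f :: "'a \<Rightarrow> real"
  define F where "F x = ennreal \<bar>f x\<bar>" for x
  assume f: "f \<in> borel_measurable \<sigma>" and fin: "Lq_norm \<sigma> (ennreal p) (\<lambda>x. ennreal \<bar>f x\<bar>) < \<infinity>"
  have "F \<in> borel_measurable \<sigma>" unfolding F_def using f by measurable
  then have F [measurable]: "F \<in> borel_measurable \<mu>" and norm:
    "Lq_norm \<sigma> (ennreal p) F = enn_powr (\<integral>\<^sup>+x. enn_powr (F x) p \<partial>\<sigma>) (1 / p)"
    using p_gt_1 by (auto simp: Lq_norm_ennreal measurable_cong_sets[OF sets_eq])
  define g where "g x = F x / dual x" for x
  have g_meas: "g \<in> borel_measurable \<nu>" unfolding g_def by measurable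
  have g_le: "(\<integral>\<^sup>+x. enn_powr (g x) p \<partial>\<nu>) \<le> (\<integral>\<^sup>+x. enn_powr (F x) p \<partial>\<sigma>)"
    unfolding g_def by (rule nn_integral_\<nu>_quotient_powr_le) (rule F)
  have "(\<integral>\<^sup>+x. enn_powr (F x) p \<partial>\<sigma>) < top"
    using fin norm unfolding F_def[symmetric]
    by (cases "(\<integral>\<^sup>+x. enn_powr (F x) p \<partial>\<sigma>) = top") (auto simp: top.not_eq_extremum)
  with g_le have g_fin: "(\<integral>\<^sup>+x. enn_powr (g x) p \<partial>\<nu>) < top" by simp
  define h where "h x = ennreal (K' * K) * (SUP S\<in>\<D>. indicator S x * (frac_weight \<mu> \<gamma> S / ennreal K * (\<integral>\<^sup>+w\<in>S. g w \<partial>\<nu>)))" for x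
  have [measurable]: "P \<in> sets \<omega>" if "P \<in> \<D>" for P
    using that \<D> sets_\<omega> sets_\<mu> by auto
  have h_meas: "h \<in> borel_measurable \<omega>"
  proof -
    have [measurable]: "(\<lambda>x. SUP S\<in>\<D>. indicator S x * (frac_weight \<mu> \<gamma> S / ennreal K * (\<integral>\<^sup>+w\<in>S. g w \<partial>\<nu>))) \<in> borel_measurable \<omega>"
      using \<D>(1) by (intro borel_measurable_SUP) (auto intro!: borel_measurable_times borel_measurable_indicator)
    show ?thesis unfolding h_def by measurable
  qed
  have "frac_maximal \<rho> \<mu> \<gamma> F x \<le> h x" for x
  proof -
    have "frac_weight \<mu> \<gamma> S * (\<integral>\<^sup>+w\<in>S. F w \<partial>\<mu>) = ennreal K * (frac_weight \<mu> \<gamma> S / ennreal K * (\<integral>\<^sup>+w\<in>S. g w \<partial>\<nu>))"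
      if "S \<in> \<D>" for S
    proof -
      have "(\<integral>\<^sup>+w\<in>S. g w \<partial>\<nu>) = (\<integral>\<^sup>+w\<in>S. F w \<partial>\<mu>)"
        unfolding g_def using that \<D> by (intro set_nn_integral_\<nu>_quotient) (auto simp: F)
      moreover have "ennreal K * (frac_weight \<mu> \<gamma> S / ennreal K) = frac_weight \<mu> \<gamma> S"
        using K by (simp add: ennreal_times_divide mult_divide_eq_ennreal mult.commute[of "ennreal K"])
      ultimately show ?thesis by (simp add: mult.assoc[symmetric])
    qed
    then have "(SUP S\<in>\<D>. indicator S x * (frac_weight \<mu> \<gamma> S * (\<integral>\<^sup>+w\<in>S. F w \<partial>\<mu>)))
      = (SUP S\<in>\<D>. ennreal K * (indicator S x * (frac_weight \<mu> \<gamma> S / ennreal K * (\<integral>\<^sup>+w\<in>S. g w \<partial>\<nu>))))"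
      by (intro SUP_cong) (auto simp: ac_simps)
    also have "\<dots> = ennreal K * (SUP S\<in>\<D>. indicator S x * (frac_weight \<mu> \<gamma> S / ennreal K * (\<integral>\<^sup>+w\<in>S. g w \<partial>\<nu>)))"
      by (rule SUP_mult_left_ennreal[symmetric])
    finally show ?thesis
      using dom[of F x] K K' unfolding h_def by (simp add: ennreal_mult mult.assoc)
  qed
  then have "Lq_norm \<omega> q (frac_maximal \<rho> \<mu> \<gamma> F) \<le> Lq_norm_meas \<omega> q h"
    unfolding Lq_norm_def using h_meas by (intro INF_lower) (auto simp: le_fun_def)
  also have "\<dots> \<le> N * enn_powr (\<integral>\<^sup>+x. enn_powr (g x) p \<partial>\<nu>) (1 / p)"
    unfolding h_def by (rule bound[OF g_meas g_fin])
  also have "\<dots> \<le> N * enn_powr (\<integral>\<^sup>+x. enn_powr (F x) p \<partial>\<sigma>) (1 / p)"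
    using g_le p_gt_1 by (intro mult_left_mono enn_powr_mono) auto
  finally show "Lq_norm \<omega> q (frac_maximal \<rho> \<mu> \<gamma> (\<lambda>x. ennreal \<bar>f x\<bar>))
    \<le> N * Lq_norm \<sigma> (ennreal p) (\<lambda>x. ennreal \<bar>f x\<bar>)"
    using norm unfolding F_def[abs_def] by simp
qed

end

section \<open>Sufficiency of testing\<close>

lemma SUP_Union_le_sum:
  fixes f :: "'b \<Rightarrow> ennreal"
  assumes "finite A"
  shows "(SUP S\<in>(\<Union>t\<in>A. \<D> t). f S) \<le> (\<Sum>t\<in>A. SUP S\<in>\<D> t. f S)"
proof (rule SUP_least)
  fix S assume "S \<in> (\<Union>t\<in>A. \<D> t)"
  then obtain t where "t \<in> A" "S \<in> \<D> t" by auto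
  then have "f S \<le> (SUP S\<in>\<D> t. f S)" by (intro SUP_upper)
  also have "\<dots> \<le> (\<Sum>t\<in>A. SUP S\<in>\<D> t. f S)"
    using \<open>t \<in> A\<close> assms by (intro member_le_sum) auto
  finally show "f S \<le> (\<Sum>t\<in>A. SUP S\<in>\<D> t. f S)" .
qed

lemma enn_powr_indicator: "enn_powr (indicator S x) a = indicator S x"
  by (cases "x \<in> S") (simp_all add: enn_powr_def)

lemma enn_powr_SUP_indicator:
  assumes "0 < a"
  shows "enn_powr (SUP S\<in>\<D>. indicator S x * f S) a = (SUP S\<in>\<D>. indicator S x * enn_powr (f S) a)"
  using assms by (simp add: enn_powr_SUP enn_powr_mult enn_powr_indicator)

section \<open>Strong type from testing with a uniform constant, for finite and for infinite
  q\<close>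

context homogeneous_space
begin

lemma dyadic_cube_emeasure:
  assumes "0 < \<delta>" "adjacent_dyadic_systems \<rho> A0 \<delta> L x0 I z Q" "S \<in> dyadic_cubes L I Q"
  shows "S \<in> sets \<mu>" "0 < emeasure \<mu> S" "emeasure \<mu> S < top"
proof -
  obtain K where "\<forall>L x0 I z Q S. adjacent_dyadic_systems \<rho> A0 \<delta> L x0 I z Q \<longrightarrow> S \<in> dyadic_cubes L I Q \<longrightarrow>
    S \<in> qborel_sets \<rho> \<and> 0 < emeasure \<mu> S \<and> emeasure \<mu> S < top \<and>
    (\<exists>y r. 0 < r \<and> S \<subseteq> qball \<rho> y r \<and> emeasure \<mu> (qball \<rho> y r) \<le> ennreal K * emeasure \<mu> S)"
    using cube_in_ball[OF assms(1)] by blast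
  then have "S \<in> qborel_sets \<rho> \<and> 0 < emeasure \<mu> S \<and> emeasure \<mu> S < top"
    using assms(2,3) by simp
  then show "S \<in> sets \<mu>" "0 < emeasure \<mu> S" "emeasure \<mu> S < top"
    by (simp_all add: sets_\<mu>)
qed

text \<open>Cubes of different systems need not be nested, so \<open>dyadic_maximal_testing\<close>
  is applied to each system alone and the bounds are added.\<close>

lemma testing_imp_strong_real:
  assumes "0 \<le> \<gamma>" "\<gamma> < 1" and pq: "1 < p" "p \<le> q" and \<delta>: "0 < \<delta>" "\<delta> < 1"
  shows "\<exists>c>0. \<forall>x0 I z Q \<sigma> \<omega> N1. adjacent_dyadic_systems \<rho> A0 \<delta> L x0 I z Q \<longrightarrow>
    sets \<sigma> = qborel_sets \<rho> \<longrightarrow> sigma_finite_measure \<sigma> \<longrightarrow> sets \<omega> = qborel_sets \<rho> \<longrightarrow>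
    absolutely_continuous \<sigma> \<mu> \<longrightarrow>
    testing_constant \<rho> \<mu> \<gamma> p (ennreal q) \<sigma> \<omega> (dyadic_cubes L I Q) N1 \<longrightarrow>
    strong_type_constant \<rho> \<mu> \<gamma> p (ennreal q) \<sigma> \<omega> (ennreal c * N1)"
proof -
  obtain K where K: "1 \<le> K"
    "\<And>L x0 I z Q S f x. adjacent_dyadic_systems \<rho> A0 \<delta> L x0 I z Q \<Longrightarrow> S \<in> dyadic_cubes L I Q \<Longrightarrow> x \<in> S \<Longrightarrow>
      frac_weight \<mu> \<gamma> S * (\<integral>\<^sup>+w\<in>S. f w \<partial>\<mu>) \<le> ennreal K * frac_maximal \<rho> \<mu> \<gamma> f x"
    using cube_average_le_frac_maximal[OF \<delta>(1) assms(1,2)] by blast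
  obtain K' where K': "1 \<le> K'"
    "\<And>L x0 I z Q f x. adjacent_dyadic_systems \<rho> A0 \<delta> L x0 I z Q \<Longrightarrow>
      frac_maximal \<rho> \<mu> \<gamma> f x \<le> ennreal K' *
      (SUP S\<in>dyadic_cubes L I Q. indicator S x * (frac_weight \<mu> \<gamma> S * (\<integral>\<^sup>+w\<in>S. f w \<partial>\<mu>)))"
    using frac_maximal_le_cube_average[OF \<delta> assms(1,2)] by blast
  \<comment> \<open>\<open>K' * K\<close> comes from exchanging balls and cubes, the root of
    \<open>Suc L\<close> from adding the systems, and the rest is the q-th root of the constant of
    \<open>dyadic_maximal_testing\<close>. \<open>Suc L\<close> in place of \<open>L\<close> keeps
    \<open>c\<close> positive for \<open>L = 0\<close>.\<close>
  define c where "c = K' * K * (real (Suc L) powr (1 / q) * (2 * level_const p powr (1 / p)))"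
  have c_pos: "0 < c"
    using K K' level_const_pos[OF pq(1)] by (simp add: c_def)
  have "strong_type_constant \<rho> \<mu> \<gamma> p (ennreal q) \<sigma> \<omega> (ennreal c * N1)"
    if sys: "adjacent_dyadic_systems \<rho> A0 \<delta> L x0 I z Q"
      and \<sigma>: "sets \<sigma> = qborel_sets \<rho>" "sigma_finite_measure \<sigma>" "absolutely_continuous \<sigma> \<mu>"
      and \<omega>: "sets \<omega> = qborel_sets \<rho>"
      and testing: "testing_constant \<rho> \<mu> \<gamma> p (ennreal q) \<sigma> \<omega> (dyadic_cubes L I Q) N1"
    for x0 I z Q \<sigma> \<omega> N1
  proof -
    interpret dual_weight_ac \<rho> A0 \<mu> \<sigma> p
      using \<sigma> pq by (auto intro!: dual_weight_ac.intro dual_weight.intro dual_weight_axioms.intro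
          dual_weight_ac_axioms.intro homogeneous_space_axioms)
    define \<D> where "\<D> = dyadic_cubes L I Q"
    define \<D>' where "\<D>' t = (\<Union>k. Q t k ` I t k)" for t
    have \<D>_eq: "\<D> = (\<Union>t\<in>{1..L}. \<D>' t)" by (simp add: \<D>_def \<D>'_def dyadic_cubes_def)
    have \<D>_props: "S \<in> sets \<mu>" "0 < emeasure \<mu> S" if "S \<in> \<D>" for S
      using dyadic_cube_emeasure[OF \<delta>(1) sys] that unfolding \<D>_def by auto
    have \<D>: "countable \<D>" "\<D> \<subseteq> sets \<mu>"
      using \<D>_props by (auto simp: \<D>_def countable_dyadic_cubes)
    have N1: "N1 < top" using testing by (simp add: testing_constant_def)
    define b where "b S = frac_weight \<mu> \<gamma> S / ennreal K" for S
    have K_pos: "0 < K" "0 \<le> K'" using K K' by auto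
    have avg: "frac_weight \<mu> \<gamma> P * (\<integral>\<^sup>+w\<in>P. f w \<partial>\<mu>) \<le> ennreal K * frac_maximal \<rho> \<mu> \<gamma> f x"
      if "P \<in> \<D>" "x \<in> P" for P x f
      using K(2)[OF sys] that by (simp add: \<D>_def)
    note tc = testing_cube[OF \<omega> \<D> K_pos(1) avg testing[folded \<D>_def], folded b_def]
    have sets_\<omega>\<nu>: "sets \<omega> = sets \<nu>" using \<omega> sets_\<mu> by simp
    \<comment> \<open>The norm bound of \<open>testing_cube\<close> raised to the power q. The
      supremum covers the cubes of all systems inside \<open>R\<close>, hence also those of any
      single one.\<close>
    have test: "(\<integral>\<^sup>+x. (SUP P\<in>{P \<in> \<D>. P \<subseteq> R}. indicator P x * enn_powr (b P * emeasure \<nu> P) q) \<partial>\<omega>)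
        \<le> enn_powr N1 q * enn_powr (emeasure \<nu> R) (q / p)" if "R \<in> \<D>" for R
    proof -
      have "(\<integral>\<^sup>+x. (SUP P\<in>{P \<in> \<D>. P \<subseteq> R}. indicator P x * enn_powr (b P * emeasure \<nu> P) q) \<partial>\<omega>)
          \<le> enn_powr (N1 * enn_powr (emeasure \<nu> R) (1 / p)) q"
        using tc(3)[OF _ _ that] pq enn_powr_le_iff_root[of "1 / q"]
        by (simp add: Lq_norm_meas_def enn_powr_SUP_indicator)
      then show ?thesis
        using pq by (simp add: enn_powr_mult enn_powr_powr)
    qed
    have "strong_type_constant \<rho> \<mu> \<gamma> p (ennreal q) \<sigma> \<omega> (ennreal c * N1)"
    proof (rule strong_type_constantI[OF \<omega> \<D> K_pos(1) K'(2)[OF sys, folded \<D>_def] _ _ K_pos(2), folded b_def])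
      show "ennreal c * N1 < \<infinity>" using N1 by (simp add: ennreal_mult_less_top)
      fix g assume g: "g \<in> borel_measurable \<nu>" and g_fin: "(\<integral>\<^sup>+x. enn_powr (g x) p \<partial>\<nu>) < top"
      define G where "G = (\<integral>\<^sup>+x. enn_powr (g x) p \<partial>\<nu>)"
      define H where "H S = enn_powr (b S * (\<integral>\<^sup>+w\<in>S. g w \<partial>\<nu>)) q" for S
      have system_bound: "(\<integral>\<^sup>+x. (SUP S\<in>\<D>' t. indicator S x * H S) \<partial>\<omega>)
          \<le> ennreal (2 powr q) * enn_powr N1 q * enn_powr (ennreal (level_const p) * G) (q / p)"
        if t: "t \<in> {1..L}" for t
      proof -
        have ds: "dyadic_system \<rho> A0 \<delta> x0 (I t) (z t) (Q t)"
          using sys t by (simp add: adjacent_dyadic_systems_def)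
        have sub: "\<D>' t \<subseteq> \<D>" using t by (auto simp: \<D>_eq)
        show ?thesis
          unfolding H_def G_def
        proof (rule dyadic_maximal_testing[OF pq g sets_\<omega>\<nu>, of "Q t" "I t", folded \<D>'_def])
          show "\<D>' t \<subseteq> sets \<nu>" using sub \<D> by auto
          show "{} \<notin> \<D>' t" using sub \<D>_props(2) by force
          fix R assume R: "R \<in> \<D>' t"
          show "emeasure \<nu> R < top" using R sub tc(1) by auto
          have "(\<integral>\<^sup>+x. (SUP P\<in>{P \<in> \<D>' t. P \<subseteq> R}. indicator P x * enn_powr (b P * emeasure \<nu> P) q) \<partial>\<omega>)
            \<le> (\<integral>\<^sup>+x. (SUP P\<in>{P \<in> \<D>. P \<subseteq> R}. indicator P x * enn_powr (b P * emeasure \<nu> P) q) \<partial>\<omega>)"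
            using sub by (intro nn_integral_mono SUP_subset_mono) auto
          also note test
          finally show "(\<integral>\<^sup>+x. (SUP P\<in>{P \<in> \<D>' t. P \<subseteq> R}. indicator P x * enn_powr (b P * emeasure \<nu> P) q) \<partial>\<omega>)
            \<le> enn_powr N1 q * enn_powr (emeasure \<nu> R) (q / p)" using R sub by auto
        qed (use dyadic_systemD(4,5)[OF ds] g_fin in auto)
      qed
      have H_meas: "(\<lambda>x. SUP S\<in>\<D>' t. indicator S x * H S) \<in> borel_measurable \<omega>" if "t \<in> {1..L}" for t
      proof -
        have sub: "\<D>' t \<subseteq> \<D>" using that by (auto simp: \<D>_eq)
        have [measurable]: "P \<in> sets \<omega>" if "P \<in> \<D>' t" for P
          using that sub \<D> sets_\<omega>\<nu> by auto
        show ?thesis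
          using countable_subset[OF sub \<D>(1)]
          by (intro borel_measurable_SUP) (auto intro!: borel_measurable_times borel_measurable_indicator)
      qed
      have "(\<integral>\<^sup>+x. enn_powr (ennreal (K' * K) * (SUP S\<in>\<D>. indicator S x * (b S * (\<integral>\<^sup>+w\<in>S. g w \<partial>\<nu>)))) q \<partial>\<omega>)
          = (\<integral>\<^sup>+x. ennreal ((K' * K) powr q) * (SUP S\<in>\<D>. indicator S x * H S) \<partial>\<omega>)"
        using pq K_pos by (simp add: enn_powr_mult enn_powr_SUP_indicator enn_powr_ennreal H_def)
      \<comment> \<open>The supremum over the union of the systems is at most the sum of their
        suprema.\<close>
      also have "\<dots> \<le> (\<integral>\<^sup>+x. ennreal ((K' * K) powr q) * (\<Sum>t\<in>{1..L}. SUP S\<in>\<D>' t. indicator S x * H S) \<partial>\<omega>)"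
        unfolding \<D>_eq by (intro nn_integral_mono mult_left_mono SUP_Union_le_sum) auto
      also have "\<dots> = ennreal ((K' * K) powr q) * (\<Sum>t\<in>{1..L}. \<integral>\<^sup>+x. (SUP S\<in>\<D>' t. indicator S x * H S) \<partial>\<omega>)"
      proof -
        have "(\<integral>\<^sup>+x. (\<Sum>t\<in>{1..L}. SUP S\<in>\<D>' t. indicator S x * H S) \<partial>\<omega>)
            = (\<Sum>t\<in>{1..L}. \<integral>\<^sup>+x. (SUP S\<in>\<D>' t. indicator S x * H S) \<partial>\<omega>)"
          by (rule nn_integral_sum) (rule H_meas)
        then show ?thesis
          using H_meas by (subst nn_integral_cmult) (auto simp del: One_nat_def)
      qed
      also have "\<dots> \<le> ennreal ((K' * K) powr q) *
          (\<Sum>t\<in>{1..L}. ennreal (2 powr q) * enn_powr N1 q * enn_powr (ennreal (level_const p) * G) (q / p))"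
        by (intro mult_left_mono sum_mono system_bound) auto
      also have "\<dots> \<le> ennreal ((K' * K) powr q) * (ennreal (real (Suc L)) *
          (ennreal (2 powr q) * enn_powr N1 q * enn_powr (ennreal (level_const p) * G) (q / p)))"
        by (intro mult_left_mono) (auto simp: ennreal_of_nat_eq_real_of_nat[symmetric] intro!: mult_right_mono)
      also have "\<dots> = enn_powr (ennreal c * N1 * enn_powr G (1 / p)) q"
      proof -
        have "ennreal (c powr q) = ennreal ((K' * K) powr q) * (ennreal (real (Suc L)) *
            (ennreal (2 powr q) * ennreal (level_const p powr (q / p))))"
          using pq K_pos level_const_pos[OF pq(1)]
          by (simp add: c_def powr_mult powr_powr ennreal_mult del: of_nat_Suc)
        then show ?thesis
          using pq c_pos level_const_pos[OF pq(1)]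
          by (simp add: enn_powr_mult enn_powr_powr enn_powr_ennreal ac_simps del: of_nat_Suc)
      qed
      finally show "Lq_norm_meas \<omega> (ennreal q) (\<lambda>x. ennreal (K' * K) * (SUP S\<in>\<D>. indicator S x * (b S * (\<integral>\<^sup>+w\<in>S. g w \<partial>\<nu>))))
          \<le> ennreal c * N1 * enn_powr (\<integral>\<^sup>+x. enn_powr (g x) p \<partial>\<nu>) (1 / p)"
        using pq enn_powr_le_iff_root[of "1 / q"] by (simp add: Lq_norm_meas_def G_def)
    qed
    then show ?thesis .
  qed
  with c_pos show ?thesis by blast
qed

text \<open>No grouping of cubes is required: the testing bound holds at almost every point of each
  cube, and Hoelder's inequality on that cube transfers it from \<open>emeasure \<nu>\<close> to the
  integral of \<open>g\<close>.\<close>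

lemma testing_imp_strong_infinity:
  assumes "0 \<le> \<gamma>" "\<gamma> < 1" and p: "1 < p" and \<delta>: "0 < \<delta>" "\<delta> < 1"
  shows "\<exists>c>0. \<forall>x0 I z Q \<sigma> \<omega> N1. adjacent_dyadic_systems \<rho> A0 \<delta> L x0 I z Q \<longrightarrow>
    sets \<sigma> = qborel_sets \<rho> \<longrightarrow> sigma_finite_measure \<sigma> \<longrightarrow> sets \<omega> = qborel_sets \<rho> \<longrightarrow>
    absolutely_continuous \<sigma> \<mu> \<longrightarrow>
    testing_constant \<rho> \<mu> \<gamma> p \<infinity> \<sigma> \<omega> (dyadic_cubes L I Q) N1 \<longrightarrow>
    strong_type_constant \<rho> \<mu> \<gamma> p \<infinity> \<sigma> \<omega> (ennreal c * N1)"
proof -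
  obtain K where K: "1 \<le> K"
    "\<And>L x0 I z Q S f x. adjacent_dyadic_systems \<rho> A0 \<delta> L x0 I z Q \<Longrightarrow> S \<in> dyadic_cubes L I Q \<Longrightarrow> x \<in> S \<Longrightarrow>
      frac_weight \<mu> \<gamma> S * (\<integral>\<^sup>+w\<in>S. f w \<partial>\<mu>) \<le> ennreal K * frac_maximal \<rho> \<mu> \<gamma> f x"
    using cube_average_le_frac_maximal[OF \<delta>(1) assms(1,2)] by blast
  obtain K' where K': "1 \<le> K'"
    "\<And>L x0 I z Q f x. adjacent_dyadic_systems \<rho> A0 \<delta> L x0 I z Q \<Longrightarrow>
      frac_maximal \<rho> \<mu> \<gamma> f x \<le> ennreal K' *
      (SUP S\<in>dyadic_cubes L I Q. indicator S x * (frac_weight \<mu> \<gamma> S * (\<integral>\<^sup>+w\<in>S. f w \<partial>\<mu>)))"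
    using frac_maximal_le_cube_average[OF \<delta> assms(1,2)] by blast
  define c where "c = K' * K * 2"
  have c_pos: "0 < c"
    using K K' by (simp add: c_def)
  have "strong_type_constant \<rho> \<mu> \<gamma> p \<infinity> \<sigma> \<omega> (ennreal c * N1)"
    if sys: "adjacent_dyadic_systems \<rho> A0 \<delta> L x0 I z Q"
      and \<sigma>: "sets \<sigma> = qborel_sets \<rho>" "sigma_finite_measure \<sigma>" "absolutely_continuous \<sigma> \<mu>"
      and \<omega>: "sets \<omega> = qborel_sets \<rho>"
      and testing: "testing_constant \<rho> \<mu> \<gamma> p \<infinity> \<sigma> \<omega> (dyadic_cubes L I Q) N1"
    for x0 I z Q \<sigma> \<omega> N1
  proof -
    interpret dual_weight_ac \<rho> A0 \<mu> \<sigma> p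
      using \<sigma> p by (auto intro!: dual_weight_ac.intro dual_weight.intro dual_weight_axioms.intro
          dual_weight_ac_axioms.intro homogeneous_space_axioms)
    define \<D> where "\<D> = dyadic_cubes L I Q"
    have \<D>: "countable \<D>" "\<D> \<subseteq> sets \<mu>"
      using dyadic_cube_emeasure(1)[OF \<delta>(1) sys] by (auto simp: \<D>_def countable_dyadic_cubes)
    have N1: "N1 < top" using testing by (simp add: testing_constant_def)
    define b where "b S = frac_weight \<mu> \<gamma> S / ennreal K" for S
    have K_pos: "0 < K" "0 \<le> K'" using K K' by auto
    have avg: "frac_weight \<mu> \<gamma> P * (\<integral>\<^sup>+w\<in>P. f w \<partial>\<mu>) \<le> ennreal K * frac_maximal \<rho> \<mu> \<gamma> f x"
      if "P \<in> \<D>" "x \<in> P" for P x f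
      using K(2)[OF sys] that by (simp add: \<D>_def)
    note tc = testing_cube[OF \<omega> \<D> K_pos(1) avg testing[folded \<D>_def], folded b_def]
    \<comment> \<open>The inequality does not depend on \<open>x\<close>, but it may fail for an
      \<omega>-null cube. Stating it for almost every point of \<open>R\<close> covers that case,
      and countability later yields one exceptional set for all cubes.\<close>
    have "AE x in \<omega>. x \<in> R \<longrightarrow> b R * emeasure \<nu> R \<le> N1 * enn_powr (emeasure \<nu> R) (1 / p)" if R: "R \<in> \<D>" for R
    proof -
      define u where "u x = (SUP P\<in>{P \<in> \<D>. P \<subseteq> R}. indicator P x * (b P * emeasure \<nu> P))" for x
      have "esssup \<omega> u \<le> N1 * enn_powr (emeasure \<nu> R) (1 / p)"
        using tc(3)[OF _ _ R] by (simp add: Lq_norm_meas_def u_def[abs_def])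
      moreover have "AE x in \<omega>. u x \<le> esssup \<omega> u" by (rule esssup_AE)
      moreover have "b R * emeasure \<nu> R \<le> u x" if "x \<in> R" for x
        unfolding u_def using that R by (intro SUP_upper2[of R]) auto
      ultimately show ?thesis
        by (elim eventually_mono) (meson order_trans)
    qed
    then have AE: "AE x in \<omega>. \<forall>R\<in>\<D>. x \<in> R \<longrightarrow> b R * emeasure \<nu> R \<le> N1 * enn_powr (emeasure \<nu> R) (1 / p)"
      using \<D>(1) by (subst AE_ball_countable) auto
    have "strong_type_constant \<rho> \<mu> \<gamma> p \<infinity> \<sigma> \<omega> (ennreal c * N1)"
    proof (rule strong_type_constantI[OF \<omega> \<D> K_pos(1) K'(2)[OF sys, folded \<D>_def] _ _ K_pos(2), folded b_def])
      show "ennreal c * N1 < \<infinity>" using N1 by (simp add: ennreal_mult_less_top)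
      fix g assume g: "g \<in> borel_measurable \<nu>" and g_fin: "(\<integral>\<^sup>+x. enn_powr (g x) p \<partial>\<nu>) < top"
      define G where "G = (\<integral>\<^sup>+x. enn_powr (g x) p \<partial>\<nu>)"
      define h where "h x = ennreal (K' * K) * (SUP S\<in>\<D>. indicator S x * (b S * (\<integral>\<^sup>+w\<in>S. g w \<partial>\<nu>)))" for x
      have cube_le: "b S * (\<integral>\<^sup>+w\<in>S. g w \<partial>\<nu>) \<le> 2 * N1 * enn_powr G (1 / p)"
        if S: "S \<in> \<D>" "b S * emeasure \<nu> S \<le> N1 * enn_powr (emeasure \<nu> S) (1 / p)" for S
      proof -
        have fin: "emeasure \<nu> S < top" using tc(1)[OF _ _ S(1)] by simp
        \<comment> \<open>Division of the testing inequality by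
          \<open>enn_powr (emeasure \<nu> S) (1 / p)\<close>; if \<open>S\<close> is \<nu>-null, the
          left-hand side is 0.\<close>
        have "b S * enn_powr (emeasure \<nu> S) (1 - 1 / p) \<le> N1"
        proof (cases "emeasure \<nu> S = 0")
          case False
          have "enn_powr (emeasure \<nu> S) (1 / p) * enn_powr (emeasure \<nu> S) (1 - 1 / p) = emeasure \<nu> S"
            using fin False p by (cases "emeasure \<nu> S")
              (auto simp: enn_powr_ennreal ennreal_mult[symmetric] powr_add[symmetric])
          then have "enn_powr (emeasure \<nu> S) (1 / p) * (b S * enn_powr (emeasure \<nu> S) (1 - 1 / p))
              = b S * emeasure \<nu> S"
            by (metis mult.left_commute)
          also have "\<dots> \<le> enn_powr (emeasure \<nu> S) (1 / p) * N1"
            using S(2) by (simp add: mult.commute)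
          finally show ?thesis
            using False fin by (subst (asm) ennreal_mult_le_mult_iff) auto
        qed simp
        then have mono: "2 * enn_powr G (1 / p) * (b S * enn_powr (emeasure \<nu> S) (1 - 1 / p))
            \<le> 2 * enn_powr G (1 / p) * N1"
          by (rule mult_left_mono) simp
        have "(\<integral>\<^sup>+w\<in>S. g w \<partial>\<nu>) \<le> 2 * enn_powr G (1 / p) * enn_powr (emeasure \<nu> S) (1 - 1 / p)"
          unfolding G_def using S(1) \<D> by (intro set_nn_integral_le_powr p g g_fin fin) auto
        then have "b S * (\<integral>\<^sup>+w\<in>S. g w \<partial>\<nu>)
            \<le> 2 * enn_powr G (1 / p) * (b S * enn_powr (emeasure \<nu> S) (1 - 1 / p))"
          by (metis mult.left_commute mult_left_mono zero_le)
        also note mono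
        finally show ?thesis by (simp only: ac_simps)
      qed
      have h_meas: "h \<in> borel_measurable \<omega>"
      proof -
        have [measurable]: "P \<in> sets \<omega>" if "P \<in> \<D>" for P
          using that \<D> \<omega> sets_\<mu> by auto
        have [measurable]: "(\<lambda>x. SUP S\<in>\<D>. indicator S x * (b S * (\<integral>\<^sup>+w\<in>S. g w \<partial>\<nu>))) \<in> borel_measurable \<omega>"
          using \<D>(1) by (intro borel_measurable_SUP) (auto intro!: borel_measurable_times borel_measurable_indicator)
        show ?thesis unfolding h_def by measurable
      qed
      have "AE x in \<omega>. h x \<le> ennreal c * N1 * enn_powr G (1 / p)"
        using AE
      proof eventually_elim
        case (elim x)
        have "h x \<le> ennreal (K' * K) * (2 * N1 * enn_powr G (1 / p))"
          unfolding h_def using elim cube_le by (intro mult_left_mono SUP_least) (auto simp: indicator_def)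
        also have "\<dots> = ennreal c * N1 * enn_powr G (1 / p)"
          using K_pos by (simp add: c_def ennreal_mult mult.assoc)
        finally show ?case .
      qed
      then show "Lq_norm_meas \<omega> \<infinity> (\<lambda>x. ennreal (K' * K) * (SUP S\<in>\<D>. indicator S x * (b S * (\<integral>\<^sup>+w\<in>S. g w \<partial>\<nu>))))
          \<le> ennreal c * N1 * enn_powr (\<integral>\<^sup>+x. enn_powr (g x) p \<partial>\<nu>) (1 / p)"
        unfolding Lq_norm_meas_def using h_meas by (auto simp: G_def h_def[abs_def] intro: esssup_I)
    qed
    then show ?thesis .
  qed
  with c_pos show ?thesis by blast
qed

end

section \<open>Necessity of testing\<close>

lemma Lq_norm_mono:
  assumes "\<And>x. u x \<le> v x"
  shows "Lq_norm M q u \<le> Lq_norm M q v"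
  unfolding Lq_norm_def using assms
  by (intro INF_superset_mono) (auto simp: le_fun_def intro: order_trans)

text \<open>A Chebyshev bound with a constant that depends on \<open>B\<close> only. For q infinite,
  some point of the non-null set \<open>B\<close> satisfies the essential bound of a given majorant,
  so the constant 1 works.\<close>

lemma Lq_norm_ge_on_set:
  assumes q: "0 < q" and B: "B \<in> sets M" "0 < emeasure M B"
  shows "\<exists>d::real>0. \<forall>c u. (\<forall>x\<in>B. c \<le> u x) \<longrightarrow> c * ennreal d \<le> Lq_norm M q u"
proof (cases "q = \<infinity>")
  case True
  have "c * ennreal 1 \<le> Lq_norm M q u" if u: "\<forall>x\<in>B. c \<le> u x" for c u
    unfolding Lq_norm_def
  proof (rule INF_greatest)
    fix h assume h: "h \<in> {h \<in> borel_measurable M. u \<le> h}"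
    have "\<exists>x\<in>B. h x \<le> esssup M h"
    proof (rule ccontr)
      assume none: "\<not> (\<exists>x\<in>B. h x \<le> esssup M h)"
      have "AE x in M. x \<notin> B"
        using esssup_AE[where M = M and f = h] by eventually_elim (use none in auto)
      then have "emeasure M B = 0"
        using B(1) by (simp add: AE_iff_null_sets[symmetric] null_setsD1)
      with B(2) show False by simp
    qed
    then obtain x where "x \<in> B" "h x \<le> esssup M h" ..
    moreover from this have "c \<le> u x" "u x \<le> h x" using u h by (auto simp: le_fun_def)
    ultimately show "c * ennreal 1 \<le> Lq_norm_meas M q h"
      using True by (simp add: Lq_norm_meas_def)
  qed
  then show ?thesis by (intro exI[of _ 1]) auto
next
  case False
  then obtain a where a: "q = ennreal a" "0 < a" using q by (cases q) auto
  \<comment> \<open>The minimum with 1 keeps the constant finite when \<open>B\<close> has infinite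
    measure.\<close>
  define D where "D = min 1 (enn_powr (emeasure M B) (1 / a))"
  have "D \<noteq> top" "D \<noteq> 0" using B(2) by (auto simp: D_def min_def)
  then obtain d where d: "D = ennreal d" "0 < d" by (cases D) auto
  have "c * ennreal d \<le> Lq_norm M q u" if u: "\<forall>x\<in>B. c \<le> u x" for c u
    unfolding Lq_norm_def
  proof (rule INF_greatest)
    fix h assume h: "h \<in> {h \<in> borel_measurable M. u \<le> h}"
    have "c * ennreal d \<le> c * enn_powr (emeasure M B) (1 / a)"
      unfolding d(1)[symmetric] D_def by (intro mult_left_mono) auto
    also have "\<dots> = enn_powr (\<integral>\<^sup>+x. enn_powr c a * indicator B x \<partial>M) (1 / a)"
      using a B by (simp add: nn_integral_cmult_indicator enn_powr_mult enn_powr_powr)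
    also have "\<dots> \<le> enn_powr (\<integral>\<^sup>+x. enn_powr (h x) a \<partial>M) (1 / a)"
    proof (intro enn_powr_mono nn_integral_mono)
      fix x show "enn_powr c a * indicator B x \<le> enn_powr (h x) a"
      proof (cases "x \<in> B")
        case True
        then have "c \<le> u x" "u x \<le> h x" using u h by (auto simp: le_fun_def)
        then have "c \<le> h x" by simp
        then show ?thesis using a True by (simp add: enn_powr_mono)
      qed simp
    qed (use a in auto)
    finally show "c * ennreal d \<le> Lq_norm_meas M q h"
      using a by (simp add: Lq_norm_meas_def)
  qed
  with d show ?thesis by blast
qed

section \<open>Consequences of the strong type inequality for functions of bounded support\<close>

context homogeneous_space
begin

lemma ex_qball_emeasure_pos:
  assumes "sets M = qborel_sets \<rho>" "A \<in> sets M" "0 < emeasure M A"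
  shows "\<exists>n. 0 < emeasure M (A \<inter> qball \<rho> y (real (Suc n)))"
proof (rule ccontr)
  assume "\<not> ?thesis"
  then have "A \<inter> qball \<rho> y (real (Suc n)) \<in> null_sets M" for n
    using sets.Int[of A M "qball \<rho> y (real (Suc n))"] assms qball_borel by (auto simp: null_sets_def)
  then have "(\<Union>n. A \<inter> qball \<rho> y (real (Suc n))) \<in> null_sets M"
    by (rule null_sets_UN)
  moreover have "\<exists>n. \<rho> x y < real (Suc n)" for x
    using reals_Archimedean2[of "\<rho> x y"] by (metis less_trans lessI of_nat_less_iff)
  then have "(\<Union>n. A \<inter> qball \<rho> y (real (Suc n))) = A"
    by (auto simp: qball_def)
  ultimately show False using assms(3) by (simp add: null_sets_def)
qed

text \<open>On a ball containing \<open>S\<close>, the maximal function of an \<open>f\<close> supported in \<open>S\<close> is at least a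
  constant multiple of \<open>\<integral> f d\<mu>\<close>; the ball can be chosen with positive \<open>\<omega>\<close>-measure.\<close>

lemma strong_type_integral_bound:
  assumes strong: "strong_type_constant \<rho> \<mu> \<gamma> p q \<sigma> \<omega> N"
    and q: "0 < q" and \<omega>: "sets \<omega> = qborel_sets \<rho>" "0 < emeasure \<omega> UNIV"
    and S: "S \<subseteq> qball \<rho> y r0"
  shows "\<exists>C\<ge>0. \<forall>f. f \<in> borel_measurable \<sigma> \<longrightarrow> (\<forall>x. x \<notin> S \<longrightarrow> f x = 0) \<longrightarrow>
    Lq_norm \<sigma> (ennreal p) (\<lambda>x. ennreal \<bar>f x\<bar>) < \<infinity> \<longrightarrow>
    (\<integral>\<^sup>+x. ennreal \<bar>f x\<bar> \<partial>\<mu>) \<le> ennreal C * Lq_norm \<sigma> (ennreal p) (\<lambda>x. ennreal \<bar>f x\<bar>)"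
proof -
  have "UNIV \<in> sets \<omega>" using sets.top[of \<omega>] space_eq_UNIV[OF \<omega>(1)] by simp
  from ex_qball_emeasure_pos[OF \<omega>(1) this \<omega>(2)]
  obtain n where n: "0 < emeasure \<omega> (qball \<rho> y (real (Suc n)))" by auto
  \<comment> \<open>One ball is to contain both \<open>S\<close> and a ball of positive
    \<omega>-measure.\<close>
  define r where "r = max r0 (real (Suc n))"
  have r: "0 < r" by (simp add: r_def less_max_iff_disj)
  define B where "B = qball \<rho> y r"
  have B: "B \<in> sets \<omega>" by (simp add: B_def \<omega> qball_borel)
  have "emeasure \<omega> (qball \<rho> y (real (Suc n))) \<le> emeasure \<omega> B"
    using B unfolding B_def by (intro emeasure_mono qball_mono) (auto simp: r_def)
  with n have "0 < emeasure \<omega> B" by simp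
  from Lq_norm_ge_on_set[OF q B this]
  obtain d :: real where d: "0 < d" "\<And>c u. (\<forall>x\<in>B. c \<le> u x) \<Longrightarrow> c * ennreal d \<le> Lq_norm \<omega> q u"
    by blast
  define w where "w = measure \<mu> B powr (\<gamma> - 1)"
  have "0 < measure \<mu> B"
    using emeasure_qball[OF r, of y] by (simp add: B_def measure_def enn2real_positive_iff)
  then have w: "0 < w" by (simp add: w_def)
  obtain N' where N': "N = ennreal N'" "0 \<le> N'"
    using strong by (cases N) (auto simp: strong_type_constant_def)
  have "(\<integral>\<^sup>+x. ennreal \<bar>f x\<bar> \<partial>\<mu>) \<le> ennreal (N' / (w * d)) * Lq_norm \<sigma> (ennreal p) (\<lambda>x. ennreal \<bar>f x\<bar>)"
    if f: "f \<in> borel_measurable \<sigma>" "\<forall>x. x \<notin> S \<longrightarrow> f x = 0" "Lq_norm \<sigma> (ennreal p) (\<lambda>x. ennreal \<bar>f x\<bar>) < \<infinity>" for f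
  proof -
    have "S \<subseteq> B" using S qball_mono[of r0 r y] by (auto simp: B_def r_def)
    then have "(\<integral>\<^sup>+x. ennreal \<bar>f x\<bar> \<partial>\<mu>) = (\<integral>\<^sup>+x\<in>B. ennreal \<bar>f x\<bar> \<partial>\<mu>)"
      using f(2) by (intro nn_integral_cong) (auto simp: indicator_def)
    then have "\<forall>x\<in>B. ennreal w * (\<integral>\<^sup>+x. ennreal \<bar>f x\<bar> \<partial>\<mu>) \<le> frac_maximal \<rho> \<mu> \<gamma> (\<lambda>x. ennreal \<bar>f x\<bar>) x"
      using frac_maximal_ge[OF r, of _ y \<gamma> "\<lambda>x. ennreal \<bar>f x\<bar>"] by (simp add: B_def w_def frac_weight_def)
    then have "ennreal w * (\<integral>\<^sup>+x. ennreal \<bar>f x\<bar> \<partial>\<mu>) * ennreal d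
        \<le> Lq_norm \<omega> q (frac_maximal \<rho> \<mu> \<gamma> (\<lambda>x. ennreal \<bar>f x\<bar>))"
      by (rule d(2))
    also have "\<dots> \<le> N * Lq_norm \<sigma> (ennreal p) (\<lambda>x. ennreal \<bar>f x\<bar>)"
      using strong f unfolding strong_type_constant_def by blast
    also have "N = ennreal (w * d) * ennreal (N' / (w * d))"
      using w d N' by (simp add: ennreal_mult[symmetric])
    finally have "ennreal (w * d) * (\<integral>\<^sup>+x. ennreal \<bar>f x\<bar> \<partial>\<mu>)
        \<le> ennreal (w * d) * (ennreal (N' / (w * d)) * Lq_norm \<sigma> (ennreal p) (\<lambda>x. ennreal \<bar>f x\<bar>))"
      using w d by (simp add: ennreal_mult ac_simps)
    then show ?thesis
      using w d by (subst (asm) ennreal_mult_le_mult_iff) auto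
  qed
  with w d N' show ?thesis by (intro exI[of _ "N' / (w * d)"]) auto
qed

text \<open>A \<sigma>-null set of positive \<mu>-measure has a bounded part of positive
  \<mu>-measure. Its indicator has norm zero but a positive \<mu>-integral, against
  \<open>strong_type_integral_bound\<close>.\<close>

lemma strong_imp_absolutely_continuous:
  assumes strong: "strong_type_constant \<rho> \<mu> \<gamma> p q \<sigma> \<omega> N"
    and q: "0 < q" and p: "0 < p" and \<omega>: "sets \<omega> = qborel_sets \<rho>" "0 < emeasure \<omega> UNIV"
    and \<sigma>: "sets \<sigma> = qborel_sets \<rho>"
  shows "absolutely_continuous \<sigma> \<mu>"
  unfolding absolutely_continuous_def
proof
  fix E assume E: "E \<in> null_sets \<sigma>"
  show "E \<in> null_sets \<mu>"
  proof (rule ccontr)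
    assume "E \<notin> null_sets \<mu>"
    then have "E \<in> sets \<mu>" "0 < emeasure \<mu> E"
      using E \<sigma> sets_\<mu> by (auto simp: null_sets_def zero_less_iff_neq_zero)
    from ex_qball_emeasure_pos[OF sets_\<mu> this]
    \<comment> \<open>Any center would do; \<open>undefined\<close> merely names a point.\<close>
    obtain n where n: "0 < emeasure \<mu> (E \<inter> qball \<rho> undefined (real (Suc n)))" by blast
    define S where "S = E \<inter> qball \<rho> undefined (real (Suc n))"
    have S_null: "S \<in> null_sets \<sigma>"
      unfolding S_def using E \<sigma> qball_borel by (intro null_set_Int2) auto
    then have [measurable]: "S \<in> sets \<sigma>" "S \<in> sets \<mu>" using \<sigma> sets_\<mu> by auto
    have ind: "ennreal \<bar>indicator S x\<bar> = indicator S x" for x :: 'a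
      by (simp add: indicator_def)
    have zero: "Lq_norm \<sigma> (ennreal p) (indicator S) = 0"
      using p S_null by (subst Lq_norm_ennreal) (auto simp: enn_powr_indicator null_sets_def)
    have "S \<subseteq> qball \<rho> undefined (real (Suc n))" by (simp add: S_def)
    from strong_type_integral_bound[OF strong q \<omega> this]
    obtain C where "\<forall>f. f \<in> borel_measurable \<sigma> \<longrightarrow> (\<forall>x. x \<notin> S \<longrightarrow> f x = 0) \<longrightarrow>
      Lq_norm \<sigma> (ennreal p) (\<lambda>x. ennreal \<bar>f x\<bar>) < \<infinity> \<longrightarrow>
      (\<integral>\<^sup>+x. ennreal \<bar>f x\<bar> \<partial>\<mu>) \<le> ennreal C * Lq_norm \<sigma> (ennreal p) (\<lambda>x. ennreal \<bar>f x\<bar>)"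
      by blast
    from this[rule_format, of "indicator S"]
    have "(\<integral>\<^sup>+x. indicator S x \<partial>\<mu>) \<le> 0"
      unfolding ind zero by simp
    then show False using n unfolding S_def[symmetric] by simp
  qed
qed

end

context dual_weight_ac
begin

text \<open>For the truncated weight on \<open>S\<close> with integral \<open>i\<close>, the
  integral bound reads \<open>i \<le> C * i powr (1 / p)\<close>. As \<open>i\<close> is finite, it
  is bounded independently of the truncation height, and monotone convergence gives the
  claim.\<close>

lemma strong_imp_dual_finite:
  assumes strong: "strong_type_constant \<rho> \<mu> \<gamma> p q \<sigma> \<omega> N"
    and q: "0 < q" and \<omega>: "sets \<omega> = qborel_sets \<rho>" "0 < emeasure \<omega> UNIV"
    and S: "S \<in> sets \<mu>" "S \<subseteq> qball \<rho> y r0" "emeasure \<mu> S < top"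
  shows "emeasure \<nu> S < top"
proof -
  note [measurable] = S(1)
  obtain C where C: "0 \<le> C" "\<forall>f. f \<in> borel_measurable \<sigma> \<longrightarrow> (\<forall>x. x \<notin> S \<longrightarrow> f x = 0) \<longrightarrow>
    Lq_norm \<sigma> (ennreal p) (\<lambda>x. ennreal \<bar>f x\<bar>) < \<infinity> \<longrightarrow>
    (\<integral>\<^sup>+x. ennreal \<bar>f x\<bar> \<partial>\<mu>) \<le> ennreal C * Lq_norm \<sigma> (ennreal p) (\<lambda>x. ennreal \<bar>f x\<bar>)"
    using strong_type_integral_bound[OF strong q \<omega> S(2)] by blast
  define F where "F n x = min (dual x) (of_nat n) * indicator S x" for n :: nat and x
  have F_meas [measurable]: "F n \<in> borel_measurable \<mu>" for n
    unfolding F_def by measurable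
  have F_fin: "F n x < top" for n x
    by (auto simp: F_def indicator_def min_less_iff_disj of_nat_less_top)
  have bound: "(\<integral>\<^sup>+x. F n x \<partial>\<mu>) \<le> enn_powr (ennreal C) (1 / (1 - 1 / p))" for n
  proof -
    define f where "f x = enn2real (F n x)" for x
    have f_eq: "ennreal \<bar>f x\<bar> = F n x" for x
      using F_fin[of n x] by (simp add: f_def)
    have "(\<integral>\<^sup>+x. F n x \<partial>\<mu>) \<le> (\<integral>\<^sup>+x. of_nat n * indicator S x \<partial>\<mu>)"
      by (intro nn_integral_mono) (auto simp: F_def indicator_def)
    also have "\<dots> < top"
      using S by (simp add: nn_integral_cmult_indicator ennreal_mult_less_top of_nat_less_top)
    finally have fin: "(\<integral>\<^sup>+x. F n x \<partial>\<mu>) < top" .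
    have "F n \<in> borel_measurable \<sigma>" by measurable
    then have norm: "Lq_norm \<sigma> (ennreal p) (F n) = enn_powr (\<integral>\<^sup>+x. enn_powr (F n x) p \<partial>\<sigma>) (1 / p)"
      using p_gt_1 by (intro Lq_norm_ennreal) auto
    \<comment> \<open>Of the p factors \<open>F n x\<close>, all but one are bounded by
      \<open>dual x\<close>, and \<open>enn_powr (dual x) (p - 1)\<close> is the Radon-Nikodym
      derivative.\<close>
    have "(\<integral>\<^sup>+x. enn_powr (F n x) p \<partial>\<sigma>) \<le> (\<integral>\<^sup>+x. RN_deriv \<sigma> \<mu> x * F n x \<partial>\<sigma>)"
    proof (intro nn_integral_mono)
      fix x
      have "enn_powr (F n x) p = F n x * enn_powr (F n x) (p - 1)"
        using enn_powr_one_plus[of "p - 1" "F n x"] p_gt_1 by simp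
      also have "\<dots> \<le> F n x * enn_powr (dual x) (p - 1)"
        using p_gt_1 by (intro mult_left_mono enn_powr_mono) (auto simp: F_def indicator_def)
      also have "enn_powr (dual x) (p - 1) = RN_deriv \<sigma> \<mu> x"
        using p_gt_1 by (simp add: dual_def enn_powr_powr)
      finally show "enn_powr (F n x) p \<le> RN_deriv \<sigma> \<mu> x * F n x" by (simp add: mult.commute)
    qed
    also have "\<dots> = (\<integral>\<^sup>+x. F n x \<partial>\<mu>)"
      by (rule nn_integral_\<mu>[symmetric]) simp
    finally have norm_le: "Lq_norm \<sigma> (ennreal p) (F n) \<le> enn_powr (\<integral>\<^sup>+x. F n x \<partial>\<mu>) (1 / p)"
      unfolding norm using p_gt_1 by (intro enn_powr_mono) auto
    moreover have "enn_powr (\<integral>\<^sup>+x. F n x \<partial>\<mu>) (1 / p) < top"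
      using fin by (simp add: top.not_eq_extremum[symmetric])
    ultimately have "Lq_norm \<sigma> (ennreal p) (F n) < top" by simp
    have "f \<in> borel_measurable \<sigma>"
      unfolding f_def using \<open>F n \<in> borel_measurable \<sigma>\<close> by measurable
    have "(\<integral>\<^sup>+x. F n x \<partial>\<mu>) \<le> ennreal C * Lq_norm \<sigma> (ennreal p) (F n)"
    proof -
      have "f x = 0" if "x \<notin> S" for x using that by (simp add: f_def F_def)
      with C(2)[rule_format, of f] \<open>f \<in> borel_measurable \<sigma>\<close> \<open>Lq_norm \<sigma> (ennreal p) (F n) < top\<close>
      show ?thesis unfolding f_eq by simp
    qed
    also have "\<dots> \<le> ennreal C * enn_powr (\<integral>\<^sup>+x. F n x \<partial>\<mu>) (1 / p)"
      by (intro mult_left_mono norm_le) simp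
    finally have le: "(\<integral>\<^sup>+x. F n x \<partial>\<mu>) \<le> ennreal C * enn_powr (\<integral>\<^sup>+x. F n x \<partial>\<mu>) (1 / p)" .
    obtain i where i: "(\<integral>\<^sup>+x. F n x \<partial>\<mu>) = ennreal i" "0 \<le> i"
      using fin by (cases "\<integral>\<^sup>+x. F n x \<partial>\<mu>") auto
    have "i powr (1 - 1 / p) \<le> C"
    proof (cases "i = 0")
      case False
      have "i \<le> C * i powr (1 / p)"
        using le i C(1) by (simp add: enn_powr_ennreal ennreal_mult[symmetric])
      then show ?thesis using False i by (simp add: powr_diff field_simps)
    qed (use C in simp)
    then have "enn_powr (ennreal i) (1 - 1 / p) \<le> ennreal C"
      using i by (simp add: enn_powr_ennreal ennreal_leI)
    then show ?thesis
      using p_gt_1 unfolding i(1) by (subst (asm) enn_powr_le_iff_root) auto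
  qed
  have "emeasure \<nu> S = (\<integral>\<^sup>+x. dual x * indicator S x \<partial>\<mu>)"
    unfolding \<nu>_def by (simp add: emeasure_density)
  also have "\<dots> = (\<integral>\<^sup>+x. (SUP n. F n x) \<partial>\<mu>)"
  proof (rule nn_integral_cong)
    fix x
    \<comment> \<open>This also holds at infinite values, because the naturals have supremum
      \<open>top\<close>.\<close>
    have "(SUP n. min (dual x) (of_nat n)) = dual x"
      using inf_SUP[of "dual x" "of_nat :: nat \<Rightarrow> ennreal" UNIV]
      by (simp add: ennreal_SUP_of_nat_eq_top inf_min[symmetric])
    then show "dual x * indicator S x = (SUP n. F n x)"
      by (simp add: F_def SUP_mult_right_ennreal[symmetric])
  qed
  also have "\<dots> = (SUP n. \<integral>\<^sup>+x. F n x \<partial>\<mu>)"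
  proof (rule nn_integral_monotone_convergence_SUP)
    show "incseq F"
      by (auto simp: incseq_def le_fun_def F_def intro!: mult_right_mono min.mono of_nat_mono)
  qed simp
  also have "\<dots> \<le> enn_powr (ennreal C) (1 / (1 - 1 / p))"
    by (intro SUP_least bound)
  also have "\<dots> < top" by (simp add: top.not_eq_extremum[symmetric])
  finally show ?thesis .
qed

text \<open>The strong type inequality concerns real-valued functions, whereas the testing weight
  may be infinite. Its real part \<open>f\<close> differs from it only on a set that is null for
  \<sigma> and for \<mu>, which changes neither the norm nor the maximal function.\<close>

lemma strong_imp_testing:
  assumes strong: "strong_type_constant \<rho> \<mu> \<gamma> p q \<sigma> \<omega> N"
    and q: "0 < q" and \<omega>: "sets \<omega> = qborel_sets \<rho>" "0 < emeasure \<omega> UNIV"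
    and \<D>: "\<And>S. S \<in> \<D> \<Longrightarrow> S \<in> sets \<mu> \<and> (\<exists>y r. 0 < r \<and> S \<subseteq> qball \<rho> y r)"
  shows "testing_constant \<rho> \<mu> \<gamma> p q \<sigma> \<omega> \<D> N"
  unfolding testing_constant_def
proof (intro conjI ballI)
  show "N < \<infinity>" using strong by (simp add: strong_type_constant_def)
  fix S assume "S \<in> \<D>"
  with \<D> obtain y r where S: "S \<in> sets \<mu>" and yr: "0 < r" "S \<subseteq> qball \<rho> y r" by blast
  note [measurable] = S
  have "emeasure \<mu> S \<le> emeasure \<mu> (qball \<rho> y r)"
    using yr by (intro emeasure_mono) (auto simp: sets_\<mu> qball_borel)
  then have "emeasure \<mu> S < top"
    using emeasure_qball(2)[OF yr(1)] by (rule le_less_trans)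
  then have "emeasure \<nu> S < top"
    by (rule strong_imp_dual_finite[OF strong q \<omega> S yr(2)])
  then show norm_fin: "Lq_norm \<sigma> (ennreal p) (testing_weight \<mu> \<sigma> p S) < \<infinity>"
    by (simp add: Lq_norm_testing_weight[OF S] top.not_eq_extremum[symmetric])
  let ?tw = "testing_weight \<mu> \<sigma> p S"
  have tw_meas: "?tw \<in> borel_measurable \<sigma>"
    unfolding testing_weight_eq[abs_def] by measurable
  define f where "f x = enn2real (?tw x)" for x
  have f_eq: "ennreal \<bar>f x\<bar> = ?tw x" if "dual x \<noteq> top" for x
    using that by (auto simp: f_def testing_weight_eq indicator_def top.not_eq_extremum[symmetric])
  have f_meas: "f \<in> borel_measurable \<sigma>"
    unfolding f_def using tw_meas by measurable
  have "AE x in \<sigma>. dual x \<noteq> top"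
    using AE_RN_finite by (simp add: dual_def)
  then have "(\<integral>\<^sup>+x. enn_powr (ennreal \<bar>f x\<bar>) p \<partial>\<sigma>) = (\<integral>\<^sup>+x. enn_powr (?tw x) p \<partial>\<sigma>)"
    by (intro nn_integral_cong_AE) (auto elim!: eventually_mono simp: f_eq)
  then have norm_eq: "Lq_norm \<sigma> (ennreal p) (\<lambda>x. ennreal \<bar>f x\<bar>) = Lq_norm \<sigma> (ennreal p) ?tw"
    using p_gt_1 f_meas tw_meas by (simp add: Lq_norm_ennreal)
  have "AE x in \<mu>. ennreal \<bar>f x\<bar> = ?tw x"
    using AE_dual by eventually_elim (simp add: f_eq)
  then have "(\<integral>\<^sup>+w\<in>A. ennreal \<bar>f w\<bar> \<partial>\<mu>) = (\<integral>\<^sup>+w\<in>A. ?tw w \<partial>\<mu>)" for A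
    by (intro nn_integral_cong_AE) (auto elim!: eventually_mono)
  then have max_eq: "frac_maximal \<rho> \<mu> \<gamma> (\<lambda>x. ennreal \<bar>f x\<bar>) = frac_maximal \<rho> \<mu> \<gamma> ?tw"
    unfolding frac_maximal_def by simp
  have "Lq_norm \<omega> q (\<lambda>x. indicator S x * frac_maximal \<rho> \<mu> \<gamma> ?tw x) \<le> Lq_norm \<omega> q (frac_maximal \<rho> \<mu> \<gamma> ?tw)"
    by (intro Lq_norm_mono) (auto simp: indicator_def)
  also have "\<dots> \<le> N * Lq_norm \<sigma> (ennreal p) ?tw"
    using strong f_meas norm_fin unfolding strong_type_constant_def norm_eq[symmetric] max_eq[symmetric]
    by blast
  finally show "Lq_norm \<omega> q (\<lambda>x. indicator S x * frac_maximal \<rho> \<mu> \<gamma> ?tw x) \<le> N * Lq_norm \<sigma> (ennreal p) ?tw" .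
qed

end

section \<open>The equivalence and the comparison of the best constants, from sufficiency and
  necessity\<close>

theorem theorem7p3:
  fixes \<rho> :: "'a \<Rightarrow> 'a \<Rightarrow> real" and \<mu> :: "'a measure"
    and A0 \<gamma> p \<delta> :: real and q :: ennreal and L :: nat
  assumes "homogeneous_type \<rho> A0 \<mu>"
    and "0 \<le> \<gamma>" "\<gamma> < 1"
    and "1 < p" "ennreal p \<le> q"
    and "0 < \<delta>" "\<delta> < 1" "96 * A0 ^ 6 * \<delta> \<le> 1"
  shows "\<exists>c::real. 0 < c \<and>
    (\<forall>x0 I z Q. \<forall>\<sigma> \<omega> :: 'a measure.
      adjacent_dyadic_systems \<rho> A0 \<delta> L x0 I z Q \<longrightarrow>
      sets \<sigma> = qborel_sets \<rho> \<longrightarrow> sigma_finite_measure \<sigma> \<longrightarrow>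
      sets \<omega> = qborel_sets \<rho> \<longrightarrow> sigma_finite_measure \<omega> \<longrightarrow> 0 < emeasure \<omega> UNIV \<longrightarrow>
      ((\<exists>N. strong_type_constant \<rho> \<mu> \<gamma> p q \<sigma> \<omega> N) \<longleftrightarrow>
        absolutely_continuous \<sigma> \<mu> \<and>
        (\<exists>N1. testing_constant \<rho> \<mu> \<gamma> p q \<sigma> \<omega> (dyadic_cubes L I Q) N1)) \<and>
      ((\<exists>N. strong_type_constant \<rho> \<mu> \<gamma> p q \<sigma> \<omega> N) \<longrightarrow>
        Inf {N. strong_type_constant \<rho> \<mu> \<gamma> p q \<sigma> \<omega> N}
          \<le> ennreal c * Inf {N1. testing_constant \<rho> \<mu> \<gamma> p q \<sigma> \<omega> (dyadic_cubes L I Q) N1}))"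
proof -
  interpret homogeneous_space \<rho> A0 \<mu> by unfold_locales (rule assms(1))
  have "\<exists>c>0. \<forall>x0 I z Q \<sigma> \<omega> N1. adjacent_dyadic_systems \<rho> A0 \<delta> L x0 I z Q \<longrightarrow>
    sets \<sigma> = qborel_sets \<rho> \<longrightarrow> sigma_finite_measure \<sigma> \<longrightarrow> sets \<omega> = qborel_sets \<rho> \<longrightarrow>
    absolutely_continuous \<sigma> \<mu> \<longrightarrow>
    testing_constant \<rho> \<mu> \<gamma> p q \<sigma> \<omega> (dyadic_cubes L I Q) N1 \<longrightarrow>
    strong_type_constant \<rho> \<mu> \<gamma> p q \<sigma> \<omega> (ennreal c * N1)"
  proof (cases q)
    case (real r)
    then have r: "q = ennreal r" "p \<le> r" using assms(4,5) by auto
    show ?thesis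
      unfolding r(1) by (rule testing_imp_strong_real) (use assms r in auto)
  next
    case top
    then show ?thesis using testing_imp_strong_infinity[OF assms(2-4,6,7), of L] by simp
  qed
  then obtain c where c: "0 < c" and suff:
    "\<And>x0 I z Q \<sigma> \<omega> N1. adjacent_dyadic_systems \<rho> A0 \<delta> L x0 I z Q \<Longrightarrow>
    sets \<sigma> = qborel_sets \<rho> \<Longrightarrow> sigma_finite_measure \<sigma> \<Longrightarrow> sets \<omega> = qborel_sets \<rho> \<Longrightarrow>
    absolutely_continuous \<sigma> \<mu> \<Longrightarrow>
    testing_constant \<rho> \<mu> \<gamma> p q \<sigma> \<omega> (dyadic_cubes L I Q) N1 \<Longrightarrow>
    strong_type_constant \<rho> \<mu> \<gamma> p q \<sigma> \<omega> (ennreal c * N1)"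
    by blast
  have q: "0 < q" using assms(4,5) by (auto intro: less_le_trans[of 0 "ennreal p"])
  show ?thesis
  proof (intro exI[of _ c] conjI c allI impI)
    fix x0 I z Q and \<sigma> \<omega> :: "'a measure"
    assume sys: "adjacent_dyadic_systems \<rho> A0 \<delta> L x0 I z Q"
      and \<sigma>: "sets \<sigma> = qborel_sets \<rho>" "sigma_finite_measure \<sigma>"
      and \<omega>: "sets \<omega> = qborel_sets \<rho>" "0 < emeasure \<omega> UNIV"
    let ?strong = "strong_type_constant \<rho> \<mu> \<gamma> p q \<sigma> \<omega>"
    let ?testing = "testing_constant \<rho> \<mu> \<gamma> p q \<sigma> \<omega> (dyadic_cubes L I Q)"
    have nec: "absolutely_continuous \<sigma> \<mu> \<and> ?testing N" if N: "?strong N" for N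
    proof -
      \<comment> \<open>Absolute continuity comes first, since the dual weight represents \<mu> only
        under it.\<close>
      have ac: "absolutely_continuous \<sigma> \<mu>"
        using assms(4) by (intro strong_imp_absolutely_continuous[OF N q _ \<omega> \<sigma>(1)]) simp
      interpret dual_weight_ac \<rho> A0 \<mu> \<sigma> p
        using \<sigma> assms(4) ac by (auto intro!: dual_weight_ac.intro dual_weight.intro dual_weight_axioms.intro
          dual_weight_ac_axioms.intro homogeneous_space_axioms)
      have "S \<in> sets \<mu> \<and> (\<exists>y r. 0 < r \<and> S \<subseteq> qball \<rho> y r)" if "S \<in> dyadic_cubes L I Q" for S
        using cube_in_ball[OF assms(6)] sys that sets_\<mu> by metis
      then show ?thesis using ac strong_imp_testing[OF N q \<omega>] by blast
    qed
    show "(\<exists>N. ?strong N) \<longleftrightarrow> absolutely_continuous \<sigma> \<mu> \<and> (\<exists>N1. ?testing N1)"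
      using nec suff[OF sys \<sigma> \<omega>(1)] by blast
    assume "\<exists>N. ?strong N"
    with nec have ac: "absolutely_continuous \<sigma> \<mu>" by blast
    \<comment> \<open>Every testing constant \<open>N1\<close> yields the strong type constant
      \<open>ennreal c * N1\<close>. Dividing by \<open>c\<close> allows to pass to the infimum over
      \<open>N1\<close>; since \<open>c\<close> is positive and finite, the factor is then moved
      back.\<close>
    have "Inf (Collect ?strong) / ennreal c \<le> Inf (Collect ?testing)"
    proof (rule Inf_greatest)
      fix N1 assume "N1 \<in> Collect ?testing"
      then have "Inf (Collect ?strong) \<le> ennreal c * N1"
        using suff[OF sys \<sigma> \<omega>(1) ac] by (intro Inf_lower) simp
      then show "Inf (Collect ?strong) / ennreal c \<le> N1"
        using c by (intro divide_le_posI_ennreal) (auto simp: mult.commute)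
    qed
    then have "ennreal c * (Inf (Collect ?strong) / ennreal c) \<le> ennreal c * Inf (Collect ?testing)"
      by (rule mult_left_mono) simp
    also have "ennreal c * (Inf (Collect ?strong) / ennreal c) = Inf (Collect ?strong)"
      using c by (simp add: ennreal_times_divide mult_divide_eq_ennreal mult.commute[of "ennreal c"])
    finally show "Inf (Collect ?strong) \<le> ennreal c * Inf (Collect ?testing)" .
  qed
qed

end
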